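(* Let $\sigma$ be a connected matching and set $\chi=123132$, $\overline{\chi}=123213$. Writing $M(z)=\mathcal{M}(\sigma,\chi,\overline{\chi},z)$, we have $$\mathcal{M}(1(\sigma+1)1,\chi,\overline{\chi},z)=\frac{1}{1-zM(z)\,C\!\left(zM(z)^{2}\right)}.$$
   Context: A matching of order $n$ is a partition of $[2n]$ into blocks (edges) of size two, identified with the word in $[n]^{2n}$ where both vertices of an edge carry the same letter and letters appear in increasing order of left vertices. A matching $\sigma$ of order $k$ is a pattern of $\tau$ if there are $i_1<\dots<i_{2k}$ with $\{i_p,i_q\}\in\tau$ iff $\{p,q\}\in\sigma$; otherwise $\tau$ avoids $\sigma$. For a set $S$ of matchings, $\mathcal{M}_n(S)$ is the set of matchings of order $n$ avoiding all of $S$, and $\mathcal{M}(S,z)=\sum_{n\ge0}|\mathcal{M}_n(S)|z^n$ (the empty matching counts for $n=0$). The juxtaposition of $\alpha,\beta$ is the word of $\alpha$ followed by the word of $\beta$ with $|\alpha|$ added to each letter; a matching is connected if it is nonempty and is not the juxtaposition of two nonempty matchings. $1(\sigma+1)1$ (the lifting of $\sigma$) is the word consisting of the letter $1$, then the word of $\sigma$ with $1$ added to each letter, then $1$. $C(z)=\sum_{n\ge0}\frac{1}{n+1}\binom{2n}{n}z^n$. *)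

theory Defs
  imports "HOL-Computational_Algebra.Formal_Power_Series"
begin

text \<open>A matching of order n, as its canonical word in [n]^(2n): every letter
  1..n occurs exactly twice and first occurrences of letters are increasing.\<close>
definition first_occ :: "nat list \<Rightarrow> nat \<Rightarrow> nat" where
  "first_occ w i = (LEAST p. p < length w \<and> w ! p = i)"

definition is_matching :: "nat \<Rightarrow> nat list \<Rightarrow> bool" where
  "is_matching n w \<longleftrightarrow> length w = 2 * n \<and> set w \<subseteq> {1..n}
     \<and> (\<forall>i\<in>{1..n}. count_list w i = 2)
     \<and> (\<forall>i j. 1 \<le> i \<longrightarrow> i < j \<longrightarrow> j \<le> n \<longrightarrow> first_occ w i < first_occ w j)"

definition order :: "nat list \<Rightarrow> nat" where
  "order w = length w div 2"

definition contains :: "nat list \<Rightarrow> nat list \<Rightarrow> bool" where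
  "contains w s \<longleftrightarrow> (\<exists>f. strict_mono_on {..<length s} f \<and> f ` {..<length s} \<subseteq> {..<length w}
      \<and> (\<forall>p<length s. \<forall>q<length s. p \<noteq> q \<longrightarrow> (w ! f p = w ! f q \<longleftrightarrow> s ! p = s ! q)))"

definition avoids :: "nat list \<Rightarrow> nat list \<Rightarrow> bool" where
  "avoids w s \<longleftrightarrow> \<not> contains w s"

definition avoiding_set :: "nat list set \<Rightarrow> nat \<Rightarrow> nat list set" where
  "avoiding_set S n = {w. is_matching n w \<and> (\<forall>s\<in>S. avoids w s)}"

definition Mgf :: "nat list set \<Rightarrow> rat fps" where
  "Mgf S = Abs_fps (\<lambda>n. of_nat (card (avoiding_set S n)))"

definition juxt :: "nat list \<Rightarrow> nat list \<Rightarrow> nat list" where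
  "juxt a b = a @ map (\<lambda>x. x + order a) b"

definition connected_matching :: "nat list \<Rightarrow> bool" where
  "connected_matching s \<longleftrightarrow> s \<noteq> [] \<and>
     \<not> (\<exists>a b ka kb. ka > 0 \<and> kb > 0 \<and> is_matching ka a \<and> is_matching kb b \<and> s = juxt a b)"

definition lift :: "nat list \<Rightarrow> nat list" where
  "lift s = 1 # map Suc s @ [1]"

definition catalan_fps :: "rat fps" where
  "catalan_fps = Abs_fps (\<lambda>n. of_nat ((2 * n) choose n) / of_nat (n + 1))"

definition chi :: "nat list" where "chi = [1,2,3,1,3,2]"
definition chibar :: "nat list" where "chibar = [1,2,3,2,1,3]"

end

theory Submission
  imports Defs "HOL-Library.Sublist"
begin

text \<open>Avoiding \<open>chi\<close> and \<open>chibar\<close> means that no edge crosses two nested edges. Hence an outer edge (one that is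
  nested in no other edge) never crosses an edge that is not outer: every other edge lies within a single gap
  between consecutive endpoints of outer edges. The outer edges form a nonnesting matching, that is, a Dyck
  path, and each gap at positive height is filled by an arbitrary \<open>chi\<close>-, \<open>chibar\<close>-avoiding matching. As the
  gap is covered by an outer edge and \<open>\<sigma>\<close> is connected, the whole matching avoids \<open>lift \<sigma>\<close> iff all fillings
  avoid \<open>\<sigma>\<close>.

  Reading the matching from left to right and writing \<open>B\<^sub>h\<close> for the generating function of the matchings that
  begin with \<open>h\<close> openers of outer edges, this gives \<open>B\<^sub>0 = 1 + B\<^sub>1\<close> and
  \<open>B\<^sub>h = M (B\<^sub>h\<^sub>+\<^sub>1 + z B\<^sub>h\<^sub>-\<^sub>1)\<close> for \<open>h > 0\<close>, whose only solution with \<open>z\<^sup>h\<close> dividing \<open>B\<^sub>h\<close> is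
  \<open>B\<^sub>h = (z M C(z M\<^sup>2))\<^sup>h B\<^sub>0\<close>.\<close>

section \<open>The Catalan series and the kernel equation\<close>

text \<open>The ratio of consecutive central binomial coefficients, cleared of denominators; in this
  form it is the coefficientwise version of the differential equation for \<open>Y\<close>
  below.\<close>

lemma catalan_recurrence:
  "of_nat (n + 2) * fps_nth catalan_fps (Suc n) = of_nat (4 * n + 2) * fps_nth catalan_fps n"
proof -
  have a: "Suc n * ((2 * Suc n) choose (Suc n)) = 2 * (2 * n + 1) * ((2 * n) choose n)"
  proof -
    have "Suc n * ((2 * Suc n) choose (Suc n)) = (2 * n + 2) * (Suc (2 * n) choose n)"
      using Suc_times_binomial_eq[of "Suc (2 * n)" n] by (simp add: algebra_simps)
    moreover have "Suc n * (Suc (2 * n) choose n) = Suc (2 * n) * ((2 * n) choose n)"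
    proof -
      have "Suc (2 * n) choose n = Suc (2 * n) choose Suc n"
        by (subst binomial_symmetric) auto
      then show ?thesis
        using Suc_times_binomial_eq[of "2 * n" n] by (simp only: mult.commute)
    qed
    ultimately show ?thesis by (simp add: algebra_simps)
  qed
  have "rat_of_nat (Suc n) * of_nat ((2 * Suc n) choose (Suc n)) = 2 * (2 * of_nat n + 1) * of_nat ((2 * n) choose n)"
    using arg_cong[OF a, of rat_of_nat] by (simp only: of_nat_mult of_nat_add) simp
  then show ?thesis
    unfolding catalan_fps_def by (simp add: field_simps del: binomial_Suc_Suc)
qed

lemma catalan_fps_eq: "catalan_fps = 1 + fps_X * catalan_fps\<^sup>2"
proof -
  \<comment> \<open>\<open>Y\<close> is the square root of \<open>1 - 4X\<close>; both are pinned down by their first-order differential equations.\<close>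
  define Y where "Y = 1 - fps_const 2 * fps_X * catalan_fps"
  have Y0: "fps_nth Y 0 = 1" by (simp add: Y_def)
  have Ysuc: "fps_nth Y (Suc n) = - 2 * fps_nth catalan_fps n" for n
    by (simp add: Y_def mult.assoc)
  have ode: "(1 - fps_const 4 * fps_X) * fps_deriv Y = - fps_const 2 * Y"
  proof (rule fps_ext)
    fix n show "fps_nth ((1 - fps_const 4 * fps_X) * fps_deriv Y) n = fps_nth (- fps_const 2 * Y) n"
    proof (cases n)
      case 0
      then show ?thesis
        by (simp add: Ysuc Y0 algebra_simps catalan_fps_def flip: One_nat_def)
           (simp add: Ysuc catalan_fps_def)
    next
      case (Suc m)
      then show ?thesis
        using catalan_recurrence[of m]
        by (simp add: Ysuc mult.assoc left_diff_distrib) (simp add: algebra_simps)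
    qed
  qed
  define Z where "Z = Y\<^sup>2"
  have odeZ: "(1 - fps_const 4 * fps_X) * fps_deriv Z = - fps_const 4 * Z"
  proof -
    have "(1 - fps_const 4 * fps_X) * fps_deriv Z = fps_const 2 * Y * ((1 - fps_const 4 * fps_X) * fps_deriv Y)"
      by (simp add: Z_def power2_eq_square algebra_simps fps_const_add[symmetric] mult_2 flip: fps_numeral_fps_const)
    also have "\<dots> = - fps_const 4 * Z"
      unfolding ode by (simp add: Z_def power2_eq_square algebra_simps flip: fps_numeral_fps_const)
    finally show ?thesis .
  qed
  have Zrec: "of_nat (Suc n) * fps_nth Z (Suc n) = 4 * (of_nat n - 1) * fps_nth Z n" for n
  proof (cases n)
    case 0 then show ?thesis
      using arg_cong[OF odeZ, of "\<lambda>f. fps_nth f 0"] by (simp add: algebra_simps)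
  next
    case (Suc m) then show ?thesis
      using arg_cong[OF odeZ, of "\<lambda>f. fps_nth f n"] by (simp add: mult.assoc left_diff_distrib)
        (simp add: algebra_simps)
  qed
  have Z0: "fps_nth Z 0 = 1" by (simp add: Z_def Y0 power2_eq_square)
  have Z1: "fps_nth Z (Suc 0) = - 4" using Zrec[of 0] Z0 by simp
  \<comment> \<open>The factor \<open>of_nat n - 1\<close> in \<open>Zrec\<close> vanishes at
    \<open>n = 1\<close>, so coefficient 2 is zero and the recurrence carries this on to all later
    ones.\<close>
  have Z2: "fps_nth Z (Suc (Suc n)) = 0" for n
  proof (induction n)
    case 0 show ?case using Zrec[of 1] by simp
  next
    case (Suc n) then show ?case using Zrec[of "Suc (Suc n)"] by simp
  qed
  have "Z = 1 - fps_const 4 * fps_X"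
  proof (rule fps_ext)
    fix n show "fps_nth Z n = fps_nth (1 - fps_const 4 * fps_X) n"
      by (cases n; cases "n - 1") (auto simp: Z0 Z1 Z2)
  qed
  then have "fps_const 4 * fps_X * (catalan_fps - 1 - fps_X * catalan_fps\<^sup>2) = 0"
    by (simp add: Z_def Y_def power2_eq_square algebra_simps flip: fps_numeral_fps_const)
  then have "catalan_fps - 1 - fps_X * catalan_fps\<^sup>2 = 0" by simp
  then show ?thesis by (simp add: algebra_simps)
qed

text \<open>Kernel method. The series \<open>E = fps_X * M * C\<close> satisfies
  \<open>E = M * (E^2 + fps_X)\<close>, so \<open>E ^ h * B 0\<close> obeys the same recurrence as
  \<open>B h\<close> and agrees with it at \<open>h = 0\<close>. Both are divisible by
  \<open>fps_X ^ h\<close>, which forces them to coincide; then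
  \<open>B 0 = 1 + E * B 0\<close>.\<close>

lemma kernel_solution:
  fixes B :: "nat \<Rightarrow> rat fps" and M :: "rat fps"
  assumes B0: "B 0 = 1 + B 1"
    and step: "\<And>h. B (Suc h) = M * (B (Suc (Suc h)) + fps_X * B h)"
    and small: "\<And>h n. n < h \<Longrightarrow> fps_nth (B h) n = 0"
  shows "B 0 = inverse (1 - fps_X * M * fps_compose catalan_fps (fps_X * M\<^sup>2))"
proof -
  define C where "C = fps_compose catalan_fps (fps_X * M\<^sup>2)"
  \<comment> \<open>The series \<open>fps_X * M^2\<close> has constant term 0, so composition with
    it respects products.\<close>
  have C: "C = 1 + fps_X * M\<^sup>2 * C\<^sup>2"
    unfolding C_def
    by (subst catalan_fps_eq)
       (simp add: fps_compose_add_distrib fps_compose_mult_distrib fps_compose_power flip: fps_compose_power)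
  define E where "E = fps_X * M * C"
  define D where "D h = B h - E ^ h * B 0" for h
  have Estep: "E = M * (E\<^sup>2 + fps_X)"
  proof -
    have "E = fps_X * M * (1 + fps_X * M\<^sup>2 * C\<^sup>2)"
      unfolding E_def using arg_cong[OF C, of "\<lambda>c. fps_X * M * c"] .
    also have "\<dots> = M * (E\<^sup>2 + fps_X)"
      by (simp add: E_def power2_eq_square algebra_simps)
    finally show ?thesis .
  qed
  have Dstep: "D (Suc h) = M * (D (Suc (Suc h)) + fps_X * D h)" for h
  proof -
    have "E ^ Suc h * B 0 = M * (E\<^sup>2 + fps_X) * (E ^ h * B 0)"
      by (subst Estep[symmetric]) (simp add: algebra_simps)
    then have "D (Suc h) = M * (B (Suc (Suc h)) + fps_X * B h) - M * (E\<^sup>2 + fps_X) * (E ^ h * B 0)"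
      unfolding D_def using step[of h] by (simp only:)
    also have "\<dots> = M * (D (Suc (Suc h)) + fps_X * D h)"
      by (simp add: D_def algebra_simps power2_eq_square)
    finally show ?thesis .
  qed
  have Esmall: "fps_nth (E ^ h * F) n = 0" if "n < h" for h n and F :: "rat fps"
  proof -
    have "E ^ h * F = fps_X ^ h * ((M * C) ^ h * F)" by (simp add: E_def power_mult_distrib algebra_simps)
    then show ?thesis using that by (simp only: fps_X_power_mult_nth if_True)
  qed
  have Dsmall: "fps_nth (D h) n = 0" if "n < h" for h n
    using that small Esmall by (simp add: D_def)
  have D0: "D 0 = 0" by (simp add: D_def)
  \<comment> \<open>Coefficient \<open>n\<close> of \<open>D h\<close> involves only smaller coefficients and coefficient \<open>n\<close> of \<open>D (h + 1)\<close>.\<close>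
  have "fps_nth (D h) n = 0" for h n
  proof (induction n arbitrary: h rule: less_induct)
    case (less n)
    \<comment> \<open>The induction descends in \<open>h\<close>: \<open>Dsmall\<close> settles
      \<open>h = Suc n\<close>, and \<open>D0\<close> settles the bottom case, which
      \<open>Dstep\<close> does not reach.\<close>
    have "fps_nth (D h) n = 0" if "h \<le> Suc n" for h
      using that
    proof (induction rule: inc_induct)
      case base then show ?case by (simp add: Dsmall)
    next
      case (step h)
      show ?case
      proof (cases h)
        case 0 then show ?thesis by (simp add: D0)
      next
        case (Suc k)
        have "fps_nth (D (Suc (Suc k)) + fps_X * D k) i = 0" if "i \<le> n" for i
          using that step.IH less.IH[of i] less.IH[of "i - 1"] Suc by (cases "i = n"; cases i) auto
        then show ?thesis unfolding Suc by (subst Dstep, subst fps_mult_nth) (simp del: fps_add_nth)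
      qed
    qed
    then show ?case using Dsmall[of n h] by (cases "h \<le> Suc n") auto
  qed
  then have "B 1 = E * B 0" by (simp add: D_def fps_eq_iff)
  then have "(1 - E) * B 0 = 1" using B0 by (simp add: algebra_simps)
  then have "inverse (1 - E) = B 0" by (rule fps_inverse_unique)
  then show ?thesis by (simp add: E_def C_def)
qed

section \<open>Canonical words\<close>

text \<open>Plays two roles: the required order of first occurrences in a matching, and a run of
  \<open>h\<close> openers of outer edges.\<close>

definition up :: "nat \<Rightarrow> nat list" where "up h = [1..<Suc h]"

lemma up_0 [simp]: "up 0 = []" by (simp add: up_def)
lemma set_up [simp]: "set (up h) = {1..h}" by (auto simp: up_def simp del: upt_Suc)
lemma length_up [simp]: "length (up h) = h" by (simp add: up_def del: upt_Suc)
lemma distinct_up [simp]: "distinct (up h)" by (simp add: up_def del: upt_Suc)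
lemma up_Suc: "up (Suc h) = up h @ [Suc h]" by (simp add: up_def)
lemma up_Suc_conv_Cons: "up (Suc h) = 1 # map Suc (up h)"
  by (simp add: up_def map_Suc_upt upt_conv_Cons del: upt_Suc)
lemma up_add: "up (m + n) = up m @ map (\<lambda>x. x + m) (up n)"
  by (induction n) (simp_all add: up_Suc)
lemma filter_up: "m \<le> n \<Longrightarrow> filter (\<lambda>x. x \<le> m) (up n) = up m"
proof (induction n)
  case (Suc n)
  have "filter (\<lambda>x. x \<le> m) (up m) = up m" by (simp add: filter_id_conv)
  then show ?case using Suc by (cases "m = Suc n") (auto simp: up_Suc)
qed simp

lemma sorted_up: "sorted_wrt (<) (up h)" by (simp add: up_def del: upt_Suc)

lemma append_eq_upD:
  assumes "xs @ ys = up n"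
  shows "length xs \<le> n" "xs = up (length xs)" "ys = map (\<lambda>x. x + length xs) (up (n - length xs))"
proof -
  show le: "length xs \<le> n" using arg_cong[OF assms, of length] by simp
  then have "xs @ ys = up (length xs) @ map (\<lambda>x. x + length xs) (up (n - length xs))"
    using assms up_add[of "length xs" "n - length xs"] by simp
  then show "xs = up (length xs)" "ys = map (\<lambda>x. x + length xs) (up (n - length xs))" by simp_all
qed

text \<open>Unlike \<open>remdups\<close>, this keeps first occurrences. It turns the
  \<open>LEAST\<close>-based condition of \<open>is_matching\<close> into a single list equation and
  behaves well under append, filtering and injective relabelling.\<close>

fun firsts :: "'a list \<Rightarrow> 'a list" where
  "firsts [] = []"
| "firsts (x # xs) = x # filter (\<lambda>y. y \<noteq> x) (firsts xs)"

lemma set_firsts [simp]: "set (firsts w) = set w" by (induction w) auto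
lemma distinct_firsts [simp]: "distinct (firsts w)" by (induction w) auto

lemma firsts_append: "firsts (u @ v) = firsts u @ filter (\<lambda>x. x \<notin> set u) (firsts v)"
  by (induction u) (auto simp: conj_commute)

lemma firsts_distinct: "distinct w \<Longrightarrow> firsts w = w"
  by (induction w) (auto simp: filter_id_conv)

lemma firsts_filter: "firsts (filter P w) = filter P (firsts w)"
  by (induction w) (auto simp: conj_commute intro: filter_cong)

lemma firsts_map: "inj_on f (set w) \<Longrightarrow> firsts (map f w) = map f (firsts w)"
proof (induction w)
  case (Cons x w)
  have "filter (\<lambda>y. y \<noteq> f x) (map f (firsts w)) = map f (filter (\<lambda>y. y \<noteq> x) (firsts w))"
    unfolding filter_map comp_def
    by (rule arg_cong[where f = "map f"], rule filter_cong) (use Cons.prems in \<open>auto simp: inj_on_def\<close>)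
  then show ?case using Cons by simp
qed simp

lemma first_occ_Cons:
  "first_occ (x # w) x = 0"
  "y \<noteq> x \<Longrightarrow> y \<in> set w \<Longrightarrow> first_occ (x # w) y = Suc (first_occ w y)"
proof -
  show "first_occ (x # w) x = 0" unfolding first_occ_def by (rule Least_eq_0) simp
  assume "y \<noteq> x" "y \<in> set w"
  then obtain i where "i < length w" "w ! i = y" by (auto simp: in_set_conv_nth)
  then show "first_occ (x # w) y = Suc (first_occ w y)"
    unfolding first_occ_def using \<open>y \<noteq> x\<close>
    by (subst Least_Suc[of _ "Suc i"]) auto
qed

lemma sorted_wrt_first_occ: "sorted_wrt (\<lambda>i j. first_occ w i < first_occ w j) (firsts w)"
proof (induction w)
  case (Cons x w)
  have "sorted_wrt (\<lambda>i j. first_occ (x # w) i < first_occ (x # w) j) (filter (\<lambda>y. y \<noteq> x) (firsts w))"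
    by (rule sorted_wrt_mono_rel[OF _ sorted_wrt_filter[OF Cons]]) (auto simp: first_occ_Cons)
  then show ?case by (auto simp: first_occ_Cons)
qed simp

text \<open>Double occurrence words.\<close>

definition dow :: "'a list \<Rightarrow> bool" where
  "dow w \<longleftrightarrow> (\<forall>x\<in>set w. count_list w x = 2)"

text \<open>\<open>firsts w\<close> is sorted by \<open>first_occ\<close>, hence sorted by size when
  first occurrences increase, and a sorted distinct list is determined by its set. Conversely, the
  length is recovered by summing the letter counts.\<close>

lemma is_matching_iff: "is_matching n w \<longleftrightarrow> firsts w = up n \<and> dow w"
proof
  assume m: "is_matching n w"
  have "x \<in> set w" if "x \<in> {1..n}" for x
    using m that by (metis count_notin is_matching_def zero_neq_numeral)
  then have s: "set w = {1..n}" using m by (auto simp: is_matching_def)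
  have "sorted_wrt (<) (firsts w)"
  proof (rule sorted_wrt_mono_rel[OF _ sorted_wrt_first_occ])
    fix i j assume ij: "i \<in> set (firsts w)" "j \<in> set (firsts w)" "first_occ w i < first_occ w j"
    then have "\<not> j < i" using m s unfolding is_matching_def
      by (metis atLeastAtMost_iff less_asym set_firsts)
    then show "i < j" using ij(3) by (cases "i = j") auto
  qed
  moreover have "sorted_wrt (<) (up n)" by (simp add: up_def del: upt_Suc)
  ultimately have "firsts w = up n"
    by (intro sorted_distinct_set_unique) (auto simp: s strict_sorted_iff)
  then show "firsts w = up n \<and> dow w" using m s by (auto simp: dow_def is_matching_def)
next
  assume a: "firsts w = up n \<and> dow w"
  then have s: "set w = {1..n}" by (metis set_firsts set_up)
  have "length w = (\<Sum>x\<in>{1..n}. count_list w x)" using sum_count_set[of w "{1..n}"] s by simp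
  also have "\<dots> = 2 * n" using a s by (simp add: dow_def)
  finally have "length w = 2 * n" .
  moreover have "first_occ w i < first_occ w j" if "1 \<le> i" "i < j" "j \<le> n" for i j
  proof -
    have "sorted_wrt (\<lambda>i j. first_occ w i < first_occ w j) (up n)" using sorted_wrt_first_occ[of w] a by simp
    from sorted_wrt_nth_less[OF this, of "i - 1" "j - 1"] that show ?thesis
      by (simp add: up_def del: upt_Suc)
  qed
  ultimately show "is_matching n w" using a s by (auto simp: is_matching_def dow_def)
qed

lemma count_list_map_inj: "inj_on f (insert x (set w)) \<Longrightarrow> count_list (map f w) (f x) = count_list w x"
  by (induction w) (auto simp: inj_on_def)

lemma dow_map: "inj_on f (set w) \<Longrightarrow> dow (map f w) \<longleftrightarrow> dow w"
proof -
  assume "inj_on f (set w)"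
  then have "count_list (map f w) (f x) = count_list w x" if "x \<in> set w" for x
    using that by (intro count_list_map_inj) (simp add: insert_absorb)
  then show ?thesis by (simp add: dow_def)
qed

lemma dow_append_disjoint: "set u \<inter> set v = {} \<Longrightarrow> dow (u @ v) \<longleftrightarrow> dow u \<and> dow v"
  unfolding dow_def by (simp add: ball_Un) (metis IntI count_notin add.right_neutral add.left_neutral empty_iff)

lemma count_list_filter: "count_list (filter P w) x = (if P x then count_list w x else 0)"
  by (induction w) auto

lemma dow_filter: "dow w \<Longrightarrow> dow (filter P w)"
  unfolding dow_def by (auto simp: count_list_filter)

lemma finite_matchings: "finite {w. is_matching n w}"
  by (rule finite_subset[OF _ finite_lists_length_eq[of "{1..n}" "2 * n"]]) (auto simp: is_matching_def)

lemma matching_Nil_iff: "is_matching 0 w \<longleftrightarrow> w = []"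
  by (auto simp: is_matching_def)

section \<open>Pattern containment as a subsequence relation\<close>

text \<open>Links the index maps of \<open>contains\<close> to the recursive \<open>subseq\<close>.
  An embedding is built by shifting a shorter one; conversely, the word is cut at the image of
  position 0.\<close>

lemma subseq_iff_embedding:
  "subseq u w \<longleftrightarrow> (\<exists>f. strict_mono_on {..<length u} f \<and> f ` {..<length u} \<subseteq> {..<length w}
      \<and> (\<forall>p<length u. w ! f p = u ! p))" (is "_ \<longleftrightarrow> (\<exists>f. ?E u w f)")
proof
  assume "subseq u w"
  then show "\<exists>f. ?E u w f"
  proof (induction rule: list_emb.induct)
    case (list_emb_Nil ys) then show ?case by (auto simp: strict_mono_on_def)
  next
    case (list_emb_Cons xs ys y)
    then obtain f where "?E xs ys f" by blast
    then have "?E xs (y # ys) (Suc \<circ> f)" by (auto simp: strict_mono_on_def)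
    then show ?case by blast
  next
    case (list_emb_Cons2 x y xs ys)
    then obtain f where f: "?E xs ys f" by blast
    have "?E (x # xs) (y # ys) (case_nat 0 (Suc \<circ> f))"
      using f list_emb_Cons2(1)
      by (auto simp: image_subset_iff strict_mono_on_def nth_Cons' less_Suc_eq_0_disj split: nat.splits)
    then show ?case by blast
  qed
next
  assume "\<exists>f. ?E u w f"
  then show "subseq u w"
  proof (induction u arbitrary: w)
    case (Cons x u)
    then obtain f where f: "?E (x # u) w f" by blast
    define i where "i = f 0"
    have i: "i < length w" "w ! i = x" using f by (auto simp: i_def image_subset_iff)
    have gt: "i < f (Suc p)" if "p < length u" for p
      using f that unfolding i_def strict_mono_on_def by auto
    have "?E u (drop (Suc i) w) (\<lambda>p. f (Suc p) - Suc i)"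
    proof (intro conjI allI impI)
      show "strict_mono_on {..<length u} (\<lambda>p. f (Suc p) - Suc i)"
      proof (rule strict_mono_onI)
        fix r s assume rs: "r \<in> {..<length u}" "s \<in> {..<length u}" "r < s"
        then have "f (Suc r) < f (Suc s)" using f by (auto simp: strict_mono_on_def)
        then show "f (Suc r) - Suc i < f (Suc s) - Suc i" using gt[of r] rs by auto
      qed
      have "f (Suc p) < length w" if "p < length u" for p
        using f that by (auto simp: image_subset_iff)
      then show "(\<lambda>p. f (Suc p) - Suc i) ` {..<length u} \<subseteq> {..<length (drop (Suc i) w)}"
        using gt i(1) by (fastforce simp: less_diff_iff)
      fix p assume "p < length u"
      then show "drop (Suc i) w ! (f (Suc p) - Suc i) = u ! p"
        using f gt[of p] i(1) by auto
    qed
    then have "subseq u (drop (Suc i) w)" using Cons.IH by blast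
    then have "subseq (x # u) (take i w @ x # drop (Suc i) w)" by (intro list_emb_append2) simp
    then show ?case using i id_take_nth_drop[of i w] by simp
  qed simp
qed

text \<open>The letter of \<open>w\<close> at the image of a position depends only on the letter of
  \<open>s\<close> there, so an index map induces a map of letters; distinct letters stay
  distinct.\<close>

lemma contains_iff: "contains w s \<longleftrightarrow> (\<exists>f. inj_on f (set s) \<and> subseq (map f s) w)"
proof
  assume "contains w s"
  then obtain e where e: "strict_mono_on {..<length s} e" "e ` {..<length s} \<subseteq> {..<length w}"
    "\<And>p q. p < length s \<Longrightarrow> q < length s \<Longrightarrow> p \<noteq> q \<Longrightarrow> w ! e p = w ! e q \<longleftrightarrow> s ! p = s ! q"
    unfolding contains_def by blast
  \<comment> \<open>An arbitrary occurrence of \<open>x\<close>: all of them are sent to the same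
    letter of \<open>w\<close>.\<close>
  define ix where "ix x = (SOME p. p < length s \<and> s ! p = x)" for x
  have ix: "ix x < length s \<and> s ! ix x = x" if "x \<in> set s" for x
    unfolding ix_def by (rule someI_ex) (use that in \<open>auto simp: in_set_conv_nth\<close>)
  define f where "f x = w ! e (ix x)" for x
  have "inj_on f (set s)" unfolding inj_on_def f_def using e(3) ix by metis
  moreover have "f (s ! p) = w ! e p" if "p < length s" for p
    unfolding f_def using e(3)[of "ix (s ! p)" p] ix[of "s ! p"] that by (cases "ix (s ! p) = p") auto
  then have "subseq (map f s) w" unfolding subseq_iff_embedding
    using e by (intro exI[of _ e]) auto
  ultimately show "\<exists>f. inj_on f (set s) \<and> subseq (map f s) w" by blast
next
  assume "\<exists>f. inj_on f (set s) \<and> subseq (map f s) w"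
  then obtain f e where "inj_on f (set s)" "strict_mono_on {..<length s} e" "e ` {..<length s} \<subseteq> {..<length w}"
    "\<And>p. p < length s \<Longrightarrow> w ! e p = f (s ! p)"
    unfolding subseq_iff_embedding by auto
  then show "contains w s" unfolding contains_def
    by (intro exI[of _ e]) (auto simp: inj_on_def)
qed

lemma contains_subseq: "contains u s \<Longrightarrow> subseq u w \<Longrightarrow> contains w s"
  unfolding contains_iff by (meson subseq_order.order_trans)

lemma set_subseq: "subseq u w \<Longrightarrow> set u \<subseteq> set w"
  by (induction rule: list_emb.induct) auto

lemma contains_map:
  assumes "inj_on g (set w)"
  shows "contains (map g w) s \<longleftrightarrow> contains w s"
proof
  assume "contains w s"
  then obtain f where f: "inj_on f (set s)" "subseq (map f s) w" unfolding contains_iff by blast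
  have "f ` set s \<subseteq> set w" using set_subseq[OF f(2)] by simp
  then have "inj_on (g \<circ> f) (set s)" using f(1) assms by (meson comp_inj_on inj_on_subset)
  moreover have "subseq (map (g \<circ> f) s) (map g w)" using subseq_map[OF f(2), of g] by simp
  ultimately show "contains (map g w) s" unfolding contains_iff by blast
next
  assume "contains (map g w) s"
  then obtain f where f: "inj_on f (set s)" "subseq (map f s) (map g w)" unfolding contains_iff by blast
  let ?h = "the_inv_into (set w) g"
  have "f ` set s \<subseteq> g ` set w" using set_subseq[OF f(2)] by simp
  then have "inj_on (?h \<circ> f) (set s)" using f(1) inj_on_the_inv_into[OF assms] by (meson comp_inj_on inj_on_subset)
  moreover have "map ?h (map g w) = w" using assms by (simp add: map_idI the_inv_into_f_f)
  then have "subseq (map (?h \<circ> f) s) w" using subseq_map[OF f(2), of ?h] by simp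
  ultimately show "contains w s" unfolding contains_iff by blast
qed

text \<open>Every letter of \<open>u\<close> occurs twice in both words, so the filtered word is as
  long as \<open>u\<close>, and a subsequence of full length is the whole word.\<close>

lemma subseq_eq_filter:
  assumes "subseq u w" "dow u" "dow w"
  shows "filter (\<lambda>x. x \<in> set u) w = u"
proof -
  let ?v = "filter (\<lambda>x. x \<in> set u) w"
  have "subseq (filter (\<lambda>x. x \<in> set u) u) ?v" using assms(1) by (rule subseq_filter)
  then have s: "subseq u ?v" by simp
  have uw: "set u \<subseteq> set w" using set_subseq[OF assms(1)] .
  then have su: "set ?v = set u" by auto
  have "length ?v = (\<Sum>x\<in>set u. count_list ?v x)" using su by (metis List.finite_set order_refl sum_count_set)
  also have "\<dots> = (\<Sum>x\<in>set u. count_list u x)"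
    using uw assms by (intro sum.cong) (auto simp: dow_def count_list_filter)
  also have "\<dots> = length u" by (simp add: sum_count_set)
  finally show ?thesis using s subseq_same_length by metis
qed

text \<open>An occurrence uses both vertices of each of its edges, so its set of letters determines
  it.\<close>

lemma contains_dow_iff:
  assumes "dow w" "dow s"
  shows "contains w s \<longleftrightarrow> (\<exists>f. inj_on f (set s) \<and> filter (\<lambda>x. x \<in> f ` set s) w = map f s)"
proof
  assume "contains w s"
  then obtain f where "inj_on f (set s)" "subseq (map f s) w" unfolding contains_iff by blast
  then show "\<exists>f. inj_on f (set s) \<and> filter (\<lambda>x. x \<in> f ` set s) w = map f s"
    using subseq_eq_filter[of "map f s" w] assms by (auto simp: dow_map)
next
  assume "\<exists>f. inj_on f (set s) \<and> filter (\<lambda>x. x \<in> f ` set s) w = map f s"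
  then show "contains w s" unfolding contains_iff by (metis subseq_filter_left)
qed

lemma sorted_wrt_subseq: "subseq u w \<Longrightarrow> sorted_wrt P w \<Longrightarrow> sorted_wrt P u"
  by (induction rule: list_emb.induct) (auto dest: set_subseq)

lemma subseq_map_inj:
  assumes "inj f"
  shows "subseq (map f u) (map f w) \<longleftrightarrow> subseq u w"
  using subseq_map[of u w f] subseq_map[of "map f u" "map f w" "inv f"] assms by (auto simp: inv_o_cancel)

lemma subseq_pair_upD: "subseq [x, y] (up h) \<Longrightarrow> x < y"
  using sorted_wrt_subseq[OF _ sorted_up] by fastforce

section \<open>Inserting and removing a closed block in a canonical word\<close>

text \<open>Makes room for the letters \<open>h + 1\<close>, ..., \<open>h + j\<close> of an
  inserted block while the \<open>h\<close> open edges keep their labels.\<close>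

definition shift_above :: "nat \<Rightarrow> nat \<Rightarrow> nat \<Rightarrow> nat" where
  "shift_above h j x = (if x \<le> h then x else x + j)"

lemma inj_shift_above: "inj (shift_above h j)"
  by (auto simp: inj_on_def shift_above_def split: if_splits)

lemma shift_above_le_iff [simp]: "shift_above h j x \<le> h \<longleftrightarrow> x \<le> h"
  by (simp add: shift_above_def)

lemma map_shift_above_up [simp]: "map (shift_above h j) (up h) = up h"
  by (intro map_idI) (simp add: shift_above_def)

lemma map_shift_above_up_add:
  "map (shift_above h j) (up (h + m)) = up h @ map (\<lambda>x. x + (h + j)) (up m)"
  by (auto simp: up_add shift_above_def)

lemma inj_plus_nat: "inj (\<lambda>x::nat. x + j)"
  by (auto simp: inj_on_def)

lemma inj_on_inj: "inj f \<Longrightarrow> inj_on f A"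
  by (rule inj_on_subset) auto

lemma set_matching: "is_matching n w \<Longrightarrow> set w = {1..n}"
  unfolding is_matching_iff by (metis set_firsts set_up)

text \<open>After the \<open>h\<close> openers, the first occurrences are those of the block
  followed by the shifted ones of \<open>b\<close>; together they again form an initial
  segment.\<close>

lemma is_matching_insert:
  assumes g: "is_matching j g" and b: "is_matching m (up h @ b)"
  shows "is_matching (j + m) (up h @ map (\<lambda>x. x + h) g @ map (shift_above h j) b)"
proof -
  let ?p = "shift_above h j" and ?g = "map (\<lambda>x. x + h) g" and ?b = "map (shift_above h j) b"
  have sg: "set ?g = {h + 1..h + j}"
    using set_matching[OF g] by (auto simp: image_iff Bex_def)
  have sb: "set ?b \<inter> {h + 1..h + j} = {}" by (auto simp: shift_above_def)
  have hm: "h \<le> m" using b append_eq_upD(1)[of "up h" _ m]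
    by (auto simp: is_matching_iff firsts_append firsts_distinct)
  have "up h @ filter (\<lambda>x. x \<notin> {1..h}) (firsts ?b) = firsts (map ?p (up h @ b))"
    by (simp add: firsts_append firsts_distinct)
  also have "\<dots> = map ?p (up (h + (m - h)))"
    using b hm by (simp add: firsts_map inj_on_inj[OF inj_shift_above] is_matching_iff del: map_append)
  also have "\<dots> = up h @ map (\<lambda>x. x + (h + j)) (up (m - h))" by (rule map_shift_above_up_add)
  finally have fb: "filter (\<lambda>x. x \<notin> {1..h}) (firsts ?b) = map (\<lambda>x. x + (h + j)) (up (m - h))" by simp
  have fg: "firsts ?g = map (\<lambda>x. x + h) (up j)"
    using g by (simp add: firsts_map inj_on_inj[OF inj_plus_nat] is_matching_iff)
  have "firsts (?g @ ?b) = firsts ?g @ firsts ?b"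
    using sb sg by (auto simp: firsts_append filter_id_conv)
  then have "firsts (up h @ ?g @ ?b) = up h @ filter (\<lambda>x. x \<notin> {1..h}) (firsts ?g) @ filter (\<lambda>x. x \<notin> {1..h}) (firsts ?b)"
    by (simp add: firsts_append[of "up h"] firsts_distinct)
  also have "filter (\<lambda>x. x \<notin> {1..h}) (firsts ?g) = firsts ?g" using sg by (auto simp: filter_id_conv)
  also have "up h @ firsts ?g @ filter (\<lambda>x. x \<notin> {1..h}) (firsts ?b) = up (h + j + (m - h))"
    unfolding fb fg by (simp only: up_add append_assoc)
  also have "h + j + (m - h) = j + m" using hm by simp
  finally have "firsts (up h @ ?g @ ?b) = up (j + m)" .
  moreover have "dow (up h @ ?g @ ?b)"
  proof -
    have "dow ?g" using g by (simp add: is_matching_iff dow_map inj_on_inj[OF inj_plus_nat])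
    moreover have "dow (map ?p (up h @ b))"
      using b by (simp add: is_matching_iff dow_map inj_on_inj[OF inj_shift_above] del: map_append)
    then have "dow (up h @ ?b)" by simp
    moreover have "set ?g \<inter> set (up h @ ?b) = {}" using sg sb by auto
    \<comment> \<open>\<open>dow\<close> depends only on letter counts, so the block may be moved to
      the front and split off there.\<close>
    ultimately have "dow (?g @ up h @ ?b)" by (subst dow_append_disjoint) auto
    then show ?thesis by (simp add: dow_def add.left_commute Un_left_commute)
  qed
  ultimately show ?thesis by (simp add: is_matching_iff)
qed

text \<open>Consecutive pieces of \<open>up n\<close> are intervals. Hence the block uses exactly
  the letters \<open>h + 1\<close>, ..., \<open>h + j\<close>, and every letter of \<open>r\<close>
  above \<open>h\<close> exceeds \<open>h + j\<close>.\<close>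

lemma is_matching_insertE:
  assumes m: "is_matching n (up h @ g' @ r)" and disj: "set g' \<inter> set r = {}" and gh: "\<And>x. x \<in> set g' \<Longrightarrow> h < x"
  obtains j g b where "j \<le> n" "is_matching j g" "g' = map (\<lambda>x. x + h) g"
    "is_matching (n - j) (up h @ b)" "r = map (shift_above h j) b"
proof -
  define F where "F = filter (\<lambda>x. x \<notin> {1..h}) (firsts r)"
  define j where "j = length (firsts g')"
  have "firsts (g' @ r) = firsts g' @ firsts r" using disj by (auto simp: firsts_append filter_id_conv)
  moreover have "filter (\<lambda>x. x \<notin> {1..h}) (firsts g') = firsts g'" using gh by (fastforce simp: filter_id_conv)
  ultimately have "firsts (up h @ g' @ r) = up h @ firsts g' @ F"
    by (simp add: firsts_append[of "up h"] firsts_distinct F_def)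
  then have "(up h @ firsts g') @ F = up n" using m by (simp add: is_matching_iff)
  from append_eq_upD[OF this] have le: "h + j \<le> n" and 1: "up h @ firsts g' = up (h + j)"
    and F: "F = map (\<lambda>x. x + (h + j)) (up (n - (h + j)))" by (simp_all add: j_def)
  have fg: "firsts g' = map (\<lambda>x. x + h) (up j)" using 1 by (simp add: up_add)
  have dm: "dow (up h @ g' @ r)" using m by (simp add: is_matching_iff)
  have u: "filter (\<lambda>x. x \<in> set g') (up h) = []" "filter (\<lambda>x. x \<notin> set g') (up h) = up h"
    using gh by (fastforce simp: filter_empty_conv filter_id_conv)+
  have rr: "filter (\<lambda>x. x \<in> set g') r = []" "filter (\<lambda>x. x \<notin> set g') r = r"
    using disj by (auto simp: filter_empty_conv filter_id_conv)
  have dg: "dow g'" using dow_filter[OF dm, of "\<lambda>x. x \<in> set g'"] u rr by simp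
  have dr: "dow (up h @ r)" using dow_filter[OF dm, of "\<lambda>x. x \<notin> set g'"] u rr by simp
  define g where "g = map (\<lambda>x. x - h) g'"
  have g: "g' = map (\<lambda>x. x + h) g"
    unfolding g_def map_map comp_def by (rule map_idI[symmetric]) (auto dest: gh)
  have "map (\<lambda>x. x + h) (firsts g) = map (\<lambda>x. x + h) (up j)"
    using fg g by (simp add: firsts_map inj_on_inj[OF inj_plus_nat])
  then have mg: "is_matching j g"
    using dg g by (simp add: is_matching_iff dow_map inj_on_inj[OF inj_plus_nat] inj_map_eq_map[OF inj_plus_nat])
  define b where "b = map (\<lambda>x. if x \<le> h then x else x - j) r"
  have "x \<le> h \<or> h + j < x" if "x \<in> set r" for x
  proof -
    have "x \<in> set F" if "h < x" using that \<open>x \<in> set r\<close> by (simp add: F_def)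
    then show ?thesis unfolding F by fastforce
  qed
  then have b: "r = map (shift_above h j) b"
    unfolding b_def map_map comp_def by (intro map_idI[symmetric]) (fastforce simp: shift_above_def)
  have "map (shift_above h j) (firsts (up h @ b)) = firsts (up h @ r)"
    using firsts_map[of "shift_above h j" "up h @ b"] b by (simp add: inj_on_inj[OF inj_shift_above])
  also have "\<dots> = up h @ F" by (simp add: firsts_append firsts_distinct F_def)
  also have "\<dots> = map (shift_above h j) (up (n - j))"
    using map_shift_above_up_add[of h j "n - (h + j)"] le F by simp
  finally have "firsts (up h @ b) = up (n - j)" by (simp add: inj_map_eq_map[OF inj_shift_above])
  moreover have "dow (up h @ b)"
    using dr b dow_map[of "shift_above h j" "up h @ b"] by (simp add: inj_on_inj[OF inj_shift_above])
  ultimately have "is_matching (n - j) (up h @ b)" by (simp add: is_matching_iff)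
  then show ?thesis using that[of j g b] le mg g b by simp
qed

text \<open>\<open>connected_matching\<close> speaks only of juxtapositions of canonical words. Any
  cut into two pieces without a common letter has this form, by removing the block \<open>u\<close>
  at \<open>h = 0\<close>.\<close>

lemma connected_matching_no_split:
  assumes "is_matching k s" "connected_matching s" "s = u @ v" "set u \<inter> set v = {}"
  shows "u = [] \<or> v = []"
proof (rule ccontr)
  assume ne: "\<not> (u = [] \<or> v = [])"
  have pos: "0 < x" if "x \<in> set u" for x
    using set_matching[OF assms(1)] assms(3) that by force
  have "is_matching k (up 0 @ u @ v)" using assms by simp
  from is_matching_insertE[OF this assms(4) pos] obtain j g b where j: "is_matching j g" "u = map (\<lambda>x. x + 0) g" "is_matching (k - j) (up 0 @ b)"
      "v = map (shift_above 0 j) b"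
    by blast
  have u: "is_matching j u" using j by simp
  have b: "is_matching (k - j) b" using j by simp
  have "v = map (\<lambda>x. x + j) b"
    unfolding j(4) by (rule map_cong) (use set_matching[OF b] in \<open>auto simp: shift_above_def\<close>)
  moreover have "order u = j" using u by (simp add: is_matching_def order_def)
  moreover have "j > 0" using u ne by (cases j) (auto simp: matching_Nil_iff)
  moreover have "k - j > 0" using b ne j(4) by (cases "k - j") (auto simp: matching_Nil_iff)
  ultimately show False using assms(2,3) u b unfolding connected_matching_def juxt_def by metis
qed

lemma subseq_middle: "subseq g (a @ g @ b)"
  by (intro subseq_drop_many subseq_rev_drop_many) simp

section \<open>Occurrences of the three kinds of patterns\<close>

lemma dow_chi: "dow chi" and dow_chibar: "dow chibar"
  by (simp_all add: dow_def chi_def chibar_def)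

lemma contains_chiI:
  assumes "distinct [a, b, c]" "subseq [a, b, c, a, c, b] w"
  shows "contains w chi"
  unfolding contains_iff
  by (rule exI[of _ "\<lambda>x. if x = 1 then a else if x = 2 then b else c"])
     (use assms in \<open>auto simp: chi_def inj_on_def\<close>)

lemma contains_chibarI:
  assumes "distinct [a, b, c]" "subseq [a, b, c, b, a, c] w"
  shows "contains w chibar"
  unfolding contains_iff
  by (rule exI[of _ "\<lambda>x. if x = 1 then a else if x = 2 then b else c"])
     (use assms in \<open>auto simp: chibar_def inj_on_def\<close>)

text \<open>Phrased with a letter set \<open>L\<close> because filtering distributes over append, so
  that an occurrence can be located piece by piece.\<close>

lemma contains_chiE:
  assumes "contains w chi" "dow w"
  obtains a b c L where "distinct [a, b, c]" "filter (\<lambda>x. x \<in> L) w = [a, b, c, a, c, b]"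
proof -
  obtain f where f: "inj_on f (set chi)" "filter (\<lambda>x. x \<in> f ` set chi) w = map f chi"
    using contains_dow_iff[OF assms(2) dow_chi] assms(1) by blast
  show ?thesis
    by (rule that[of "f 1" "f 2" "f 3" "f ` set chi"])
       (use f(1) in \<open>auto simp: f(2) inj_on_def\<close>, auto simp: chi_def)
qed

lemma contains_chibarE:
  assumes "contains w chibar" "dow w"
  obtains a b c L where "distinct [a, b, c]" "filter (\<lambda>x. x \<in> L) w = [a, b, c, b, a, c]"
proof -
  obtain f where f: "inj_on f (set chibar)" "filter (\<lambda>x. x \<in> f ` set chibar) w = map f chibar"
    using contains_dow_iff[OF assms(2) dow_chibar] assms(1) by blast
  show ?thesis
    by (rule that[of "f 1" "f 2" "f 3" "f ` set chibar"])
       (use f(1) in \<open>auto simp: f(2) inj_on_def\<close>, auto simp: chibar_def)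
qed

lemma contains_liftI:
  assumes "is_matching k s" "inj_on f (set s)" "x \<notin> f ` set s" "subseq (x # map f s @ [x]) w"
  shows "contains w (lift s)"
  unfolding contains_iff
proof (intro exI[of _ "\<lambda>y. if y = 1 then x else f (y - 1)"] conjI)
  show "inj_on (\<lambda>y. if y = 1 then x else f (y - 1)) (set (lift s))"
    using assms(2,3) unfolding lift_def inj_on_def by auto
  have "map (\<lambda>y. if y = 1 then x else f (y - 1)) (lift s) = x # map f s @ [x]"
    using set_matching[OF assms(1)] by (auto simp: lift_def)
  then show "subseq (map (\<lambda>y. if y = 1 then x else f (y - 1)) (lift s)) w"
    using assms(4) by simp
qed

lemma contains_liftE:
  assumes "contains w (lift s)" "dow w" "is_matching k s"
  obtains f x L where "inj_on f (set s)" "x \<notin> f ` set s" "filter (\<lambda>y. y \<in> L) w = x # map f s @ [x]"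
proof -
  \<comment> \<open>Hence the new letter 1 does not occur in \<open>map Suc s\<close>, and
    \<open>lift s\<close> is a double occurrence word as well.\<close>
  have z: "0 \<notin> set s" using set_matching[OF assms(3)] by simp
  have "dow (map Suc s)" using assms(3) by (simp add: is_matching_iff dow_map)
  moreover have "count_list (map Suc s) 1 = 0" using z by (intro count_notin) auto
  ultimately have "dow (lift s)" using z unfolding lift_def dow_def by auto
  then obtain f where f: "inj_on f (set (lift s))" "filter (\<lambda>x. x \<in> f ` set (lift s)) w = map f (lift s)"
    using contains_dow_iff[OF assms(2)] assms(1) by blast
  show ?thesis
    by (rule that[of "f \<circ> Suc" "f 1" "f ` set (lift s)"])
       (use f z in \<open>auto simp: lift_def inj_on_def\<close>)
qed

lemma subseq_outer: "subseq (a @ b) (a @ g @ b)"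
  by (intro list_emb_append_mono) auto

section \<open>Inserting a closed block\<close>

text \<open>No nonempty proper factor is a union of edges. This is stronger than being connected:
  the interior of \<open>lift s\<close> is such a factor for every nonempty matching
  \<open>s\<close>, which is why \<open>lift s\<close> is treated separately below.\<close>

definition blockless :: "'a list \<Rightarrow> bool" where
  "blockless s \<longleftrightarrow> (\<forall>u1 u2 u3. s = u1 @ u2 @ u3 \<longrightarrow> set u2 \<inter> (set u1 \<union> set u3) = {} \<longrightarrow>
     u2 = [] \<or> (u1 = [] \<and> u3 = []))"

text \<open>The equation is oriented so that \<open>append_eq_Cons_conv\<close> enumerates the
  finitely many factorisations of a concrete word.\<close>

lemma blocklessI:
  assumes "\<And>u1 u2 u3. u1 @ u2 @ u3 = s \<Longrightarrow>
    u2 = [] \<or> (u1 = [] \<and> u3 = []) \<or> (\<exists>x\<in>set u2. x \<in> set u1 \<or> x \<in> set u3)"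
  shows "blockless s"
  using assms unfolding blockless_def by blast

lemma blockless_chi: "blockless chi"
  by (rule blocklessI) (auto simp: chi_def append_eq_Cons_conv)

lemma blockless_chibar: "blockless chibar"
  by (rule blocklessI) (auto simp: chibar_def append_eq_Cons_conv)

text \<open>An occurrence is cut by \<open>a\<close>, \<open>g\<close>, \<open>b\<close> into three
  factors, the middle one sharing no letter with the others. A blockless pattern then lies entirely
  in \<open>g\<close> or entirely outside it.\<close>

lemma avoids_insert_blockless:
  assumes s: "blockless s" "dow s"
    and w: "dow (a @ g @ b)" "set g \<inter> (set a \<union> set b) = {}" "avoids g s" "avoids (a @ b) s"
  shows "avoids (a @ g @ b) s"
  unfolding avoids_def
proof
  assume "contains (a @ g @ b) s"
  then obtain f where inj: "inj_on f (set s)" and f: "filter (\<lambda>x. x \<in> f ` set s) (a @ g @ b) = map f s"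
    using contains_dow_iff[OF w(1) s(2)] by blast
  define u1 u2 u3 where u: "u1 = filter (\<lambda>x. x \<in> f ` set s) a" "u2 = filter (\<lambda>x. x \<in> f ` set s) g"
    "u3 = filter (\<lambda>x. x \<in> f ` set s) b"
  have e: "map f s = u1 @ u2 @ u3" using f by (simp add: u)
  then obtain t1 t' where t': "s = t1 @ t'" "map f t1 = u1" "map f t' = u2 @ u3"
    by (metis map_eq_append_conv)
  then obtain t2 t3 where t: "s = t1 @ t2 @ t3" "map f t1 = u1" "map f t2 = u2" "map f t3 = u3"
    by (metis map_eq_append_conv)
  have "set u2 \<inter> (set u1 \<union> set u3) = {}" using w(2) by (auto simp: u)
  then have "set t2 \<inter> (set t1 \<union> set t3) = {}" by (simp add: t(2-4)[symmetric]) blast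
  then consider "t2 = []" | "t1 = []" "t3 = []" using s(1) t(1) unfolding blockless_def by blast
  then show False
  proof cases
    case 1
    then have "map f s = u1 @ u3" using e t(3) by simp
    then have "subseq (map f s) (a @ b)" by (simp add: u list_emb_append_mono)
    then show False using w(4) inj by (auto simp: avoids_def contains_iff)
  next
    case 2
    then have "map f s = u2" using e t(2,4) by simp
    then have "subseq (map f s) g" by (simp add: u)
    then show False using w(3) inj by (auto simp: avoids_def contains_iff)
  qed
qed

lemma subseq_pair_leD:
  assumes "filter (\<lambda>x. x \<le> h) b = up h" "subseq [x, y] b" "x \<le> h" "y \<le> h"
  shows "x < y"
  using subseq_filter[OF assms(2), of "\<lambda>x. x \<le> h"] assms subseq_pair_upD by simp

text \<open>If an occurrence of \<open>lift s\<close> lies neither within the block nor outside it,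
  its enclosing edge \<open>x\<close> opens in \<open>up h\<close> and closes in \<open>b\<close>.
  The closing order excludes further openers inside \<open>x\<close>, connectedness then excludes
  letters of \<open>b\<close>, and a copy of \<open>s\<close> in \<open>g\<close> remains.\<close>

lemma avoids_insert_lift:
  assumes s: "is_matching k s" "connected_matching s"
    and d: "dow (up h @ g @ b)" and disj: "set g \<inter> (set (up h) \<union> set b) = {}"
    and b: "filter (\<lambda>x. x \<le> h) b = up h"
    and g: "avoids g s" and ab: "avoids (up h @ b) (lift s)"
  shows "avoids (up h @ g @ b) (lift s)"
  unfolding avoids_def
proof
  assume "contains (up h @ g @ b) (lift s)"
  from contains_liftE[OF this d s(1)] obtain f x L where
    inj: "inj_on f (set s)" and x: "x \<notin> f ` set s"
    and f: "filter (\<lambda>y. y \<in> L) (up h @ g @ b) = x # map f s @ [x]" by blast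
  define u1 u2 u3 where u: "u1 = filter (\<lambda>y. y \<in> L) (up h)" "u2 = filter (\<lambda>y. y \<in> L) g" "u3 = filter (\<lambda>y. y \<in> L) b"
  have e: "u1 @ u2 @ u3 = x # map f s @ [x]" using f by (simp add: u)
  have l: "(if u3 \<noteq> [] then last u3 else last (u1 @ u2)) = x"
    using arg_cong[OF e, of last] by (auto simp: last_append)
  have dis: "set u2 \<inter> set u1 = {}" "set u2 \<inter> set u3 = {}" using disj by (auto simp: u)
  have su: "subseq u1 (up h)" "subseq u2 g" "subseq u3 b" by (auto simp: u)
  have ng: "\<not> subseq (map f s) g" using g inj by (auto simp: avoids_def contains_iff)
  have "u2 \<noteq> []"
  proof
    assume "u2 = []"
    then have "subseq (x # map f s @ [x]) (up h @ b)" using e list_emb_append_mono[OF su(1,3)] by simp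
    then show False using contains_liftI[OF s(1) inj x] ab by (auto simp: avoids_def)
  qed
  have "u1 \<noteq> []"
  proof
    assume "u1 = []"
    then have "x \<in> set u2" using e \<open>u2 \<noteq> []\<close> by (cases u2) auto
    then have "x \<notin> set u3" using dis by auto
    then have "u3 = []" using l last_in_set[of u3] by (auto split: if_splits)
    then have "subseq (map f s) u2" using e \<open>u1 = []\<close> subseq_middle[of "map f s" "[x]" "[x]"] by simp
    then show False using ng su(2) subseq_order.order_trans by blast
  qed
  then obtain s1 where s1: "u1 = x # s1" using e by (cases u1) auto
  have "u3 \<noteq> []"
  proof
    assume "u3 = []"
    then have "x \<in> set u2" using l \<open>u2 \<noteq> []\<close> by auto
    then show False using dis s1 by auto
  qed
  then obtain s2 where s2: "u3 = s2 @ [x]"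
    using l append_butlast_last_id[of u3] by metis
  have e': "map f s = s1 @ u2 @ s2" using e s1 s2 by simp
  \<comment> \<open>An edge \<open>y\<close> opened after \<open>x\<close> but closed before it
    would be nested in \<open>x\<close>, against the closing order prescribed for
    \<open>b\<close>.\<close>
  have "s1 = []"
  proof (rule ccontr)
    assume "s1 \<noteq> []"
    then obtain y s1' where y: "s1 = y # s1'" by (cases s1) auto
    have "subseq [x, y] (up h)" using su(1) s1 y subseq_order.order_trans[of "[x, y]" u1] by simp
    then have xy: "x < y" "x \<le> h" "y \<le> h" using subseq_pair_upD set_subseq[of "[x, y]" "up h"] by auto
    have "dow (map f s)" using s(1) inj by (simp add: dow_map is_matching_iff)
    then have "count_list (map f s) y = 2" using e' y by (simp add: dow_def)
    moreover have "y \<notin> set u2" using dis s1 y by auto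
    moreover have "distinct u1" by (simp add: u)
    then have "y \<notin> set s1'" using s1 y by auto
    ultimately have "count_list s2 y = 1" using e' y by (simp add: count_notin)
    then have "y \<in> set s2" using count_notin by fastforce
    then have "subseq ([y] @ [x]) (s2 @ [x])" by (intro list_emb_append_mono) (auto simp: subseq_singleton_left)
    then have "subseq [y, x] b" using su(3) s2 subseq_order.order_trans by fastforce
    then show False using subseq_pair_leD[OF b] xy by fastforce
  qed
  show False
  proof (cases "s2 = []")
    case True
    then show False using e' \<open>s1 = []\<close> ng su(2) by simp
  next
    case False
    obtain t1 t2 where t: "s = t1 @ t2" "map f t1 = u2" "map f t2 = s2"
      using e' \<open>s1 = []\<close> by (auto simp: map_eq_append_conv)
    then have "set t1 \<inter> set t2 = {}" using dis s2 by fastforce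
    then show False using connected_matching_no_split[OF s t(1)] t False \<open>u2 \<noteq> []\<close> by auto
  qed
qed

section \<open>Peeling off the outer edges\<close>

lemma filter_eq_replicate: "filter (\<lambda>x. x = y) w = replicate (count_list w y) y"
  by (induction w) auto

lemma subseq_pairE:
  assumes "subseq [x, y] w"
  obtains u v where "w = u @ x # v" "y \<in> set v"
  using list_emb_ConsD[OF assms] by (auto simp: subseq_singleton_left)

lemma subseq_pairI: "y \<in> set v \<Longrightarrow> subseq [x, y] (u @ x # v)"
  by (intro subseq_drop_many) (simp add: subseq_singleton_left)

text \<open>Edge 1 is deleted and all other letters are lowered by one. The letter 0 is excluded
  since \<open>Suc\<close> would turn it into a further 1.\<close>

lemma is_matching_close_first:
  assumes "0 \<notin> set u \<union> set t"
  shows "is_matching (Suc m) (1 # map Suc u @ 1 # map Suc t) \<longleftrightarrow> is_matching m (u @ t)"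
proof -
  let ?w = "1 # map Suc u @ 1 # map Suc t"
  have no1: "1 \<notin> set (map Suc u)" "1 \<notin> set (map Suc t)" using assms by auto
  have "filter (\<lambda>y. y \<noteq> 1) (map Suc x) = map Suc x" if "0 \<notin> set x" for x
    using that by (induction x) auto
  then have f: "filter (\<lambda>y. y \<noteq> 1) (map Suc u @ 1 # map Suc t) = map Suc (u @ t)"
    using assms by simp
  have "firsts ?w = 1 # map Suc (firsts (u @ t))"
    by (simp only: firsts.simps firsts_filter[symmetric] f) (simp add: firsts_map del: map_append)
  then have 1: "firsts ?w = up (Suc m) \<longleftrightarrow> firsts (u @ t) = up m"
    by (simp add: up_Suc_conv_Cons inj_map_eq_map)
  have c: "count_list (map Suc u) 1 = 0" "count_list (map Suc t) 1 = 0" by (rule no1[THEN count_notin])+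
  have "dow ?w \<longleftrightarrow> dow (map Suc (u @ t))"
    using c assms unfolding dow_def by auto
  also have "\<dots> \<longleftrightarrow> dow (u @ t)" by (rule dow_map) simp
  finally show ?thesis using 1 by (simp add: is_matching_iff)
qed

locale connected_pattern =
  fixes \<sigma> :: "nat list" and k :: nat
  assumes matching: "is_matching k \<sigma>" and conn: "connected_matching \<sigma>"
begin

text \<open>A word in \<open>B h n\<close> is what remains of an admissible matching to the right of \<open>h\<close> consecutive openers
  of outer edges: the filter condition says that these edges are closed first in, first out, that is, none of
  them is nested in another. \<open>A h n\<close> collects the remainders that go on at once with an endpoint of an
  outer edge, the opener \<open>h + 1\<close> or the closer \<open>1\<close>, without filling the gap before it.\<close>

definition B :: "nat \<Rightarrow> nat \<Rightarrow> nat list set" where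
  "B h n = {v. up h @ v \<in> avoiding_set {lift \<sigma>, chi, chibar} n \<and> filter (\<lambda>x. x \<le> h) v = up h}"

definition A :: "nat \<Rightarrow> nat \<Rightarrow> nat list set" where
  "A h n = (#) (Suc h) ` B (Suc h) n \<union> (if n = 0 then {} else (\<lambda>v. 1 # map Suc v) ` B (h - 1) (n - 1))"

lemma nonempty: "\<sigma> \<noteq> []" using conn by (simp add: connected_matching_def)

lemma B_matching: "v \<in> B h n \<Longrightarrow> is_matching n (up h @ v)"
  by (simp add: B_def avoiding_set_def)

lemma finite_avoiding_set: "finite (avoiding_set S n)"
  by (rule finite_subset[OF _ finite_matchings[of n]]) (auto simp: avoiding_set_def)

lemma finite_B: "finite (B h n)"
proof -
  have "(@) (up h) ` B h n \<subseteq> avoiding_set {lift \<sigma>, chi, chibar} n" by (auto simp: B_def)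
  then have "finite ((@) (up h) ` B h n)" using finite_avoiding_set finite_subset by blast
  then show ?thesis by (rule finite_imageD) (auto simp: inj_on_def)
qed

lemma finite_A: "finite (A h n)" by (simp add: A_def finite_B)

lemma B_0: "B 0 n = avoiding_set {lift \<sigma>, chi, chibar} n"
proof -
  have "filter (\<lambda>x. x \<le> 0) w = []" if "is_matching n w" for w
    using set_matching[OF that] by (fastforce simp: filter_empty_conv)
  then show ?thesis by (auto simp: B_def avoiding_set_def)
qed

text \<open>Supplies the divisibility by \<open>fps_X ^ h\<close> that singles out the solution in
  \<open>kernel_solution\<close>.\<close>

lemma B_empty:
  assumes "n < h"
  shows "B h n = {}"
proof -
  have False if "is_matching n (up h @ v)" for v
    using append_eq_upD(1)[of "up h" _ n] that assms by (auto simp: is_matching_iff firsts_append firsts_distinct)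
  then show ?thesis using B_matching by blast
qed

lemma B_0_0: "B 0 0 = {[]}"
  by (auto simp: B_0 avoiding_set_def matching_Nil_iff avoids_def contains_iff lift_def chi_def chibar_def)

text \<open>The first opener is always outer, and with one open edge the condition on the closing
  order is automatic, since the letter 1 occurs exactly once more.\<close>

lemma B_0_pos:
  assumes "n > 0"
  shows "B 0 n = (#) 1 ` B 1 n"
proof (intro equalityI subsetI)
  fix w assume w: "w \<in> B 0 n"
  then have m: "is_matching n w" using B_matching by fastforce
  then have "w \<noteq> []" using assms by (auto simp: is_matching_def)
  then obtain x v where xv: "w = x # v" by (cases w) auto
  have "x = 1" using m assms xv by (cases n) (auto simp: is_matching_iff up_Suc_conv_Cons)
  have "set v \<subseteq> {1..n}" using set_matching[OF m] xv by auto
  then have "filter (\<lambda>x. x \<le> 1) v = filter (\<lambda>x. x = 1) v" by (intro filter_cong) auto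
  also have "\<dots> = [1]"
  proof -
    have "count_list w 1 = 2" using m xv \<open>x = 1\<close> by (simp add: is_matching_iff dow_def)
    then have "count_list v 1 = 1" using xv \<open>x = 1\<close> by simp
    then show ?thesis by (simp add: filter_eq_replicate)
  qed
  finally have "v \<in> B 1 n" using w xv \<open>x = 1\<close> by (simp add: B_def up_Suc)
  then show "w \<in> (#) 1 ` B 1 n" using xv \<open>x = 1\<close> by simp
next
  fix w assume "w \<in> (#) 1 ` B 1 n"
  then show "w \<in> B 0 n" unfolding B_0 by (auto simp: B_def up_Suc)
qed

section \<open>Prefixing and removing an endpoint of an outer edge\<close>

lemma B_Suc_Cons: "v \<in> B (Suc h) n \<Longrightarrow> Suc h # v \<in> B h n"
proof -
  assume v: "v \<in> B (Suc h) n"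
  have "filter (\<lambda>x. x \<le> h) v = filter (\<lambda>x. x \<le> h) (filter (\<lambda>x. x \<le> Suc h) v)"
    by (auto intro: filter_cong)
  also have "\<dots> = up h" using v by (simp add: B_def filter_up)
  finally show ?thesis using v by (simp add: B_def up_Suc)
qed

text \<open>Occurrences that omit edge 1 come from \<open>up h @ v\<close>. In all others edge 1
  comes first, and only distinct, increasing openers stand between its ends. For \<open>chi\<close>
  this leaves two nested edges, against the closing order; for \<open>chibar\<close> and
  \<open>lift \<sigma>\<close> a letter would have to be repeated there.\<close>

lemma avoids_close_first:
  assumes d: "dow (1 # map Suc (up h) @ 1 # map Suc v)"
    and v: "filter (\<lambda>x. x \<le> h) v = up h" "0 \<notin> set v"
    and av: "\<forall>s\<in>{lift \<sigma>, chi, chibar}. avoids (up h @ v) s"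
  shows "\<forall>s\<in>{lift \<sigma>, chi, chibar}. avoids (1 # map Suc (up h) @ 1 # map Suc v) s"
proof -
  let ?w = "1 # map Suc (up h) @ 1 # map Suc v"
  let ?u = "\<lambda>L. filter (\<lambda>x. x \<in> L) (map Suc (up h))" and ?t = "\<lambda>L. filter (\<lambda>x. x \<in> L) (map Suc v)"
  have av': "avoids (map Suc (up h @ v)) s" if "s \<in> {lift \<sigma>, chi, chibar}" for s
    using av that by (auto simp: avoids_def contains_map simp del: map_append)
  have skip: "subseq (filter (\<lambda>x. x \<in> L) ?w) (map Suc (up h @ v))" if "1 \<notin> L" for L
    using that by (simp add: list_emb_append_mono)
  have use1: "filter (\<lambda>x. x \<in> L) ?w = 1 # ?u L @ 1 # ?t L" if "1 \<in> L" for L using that by simp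
  have no1: "1 \<notin> set (?u L)" "1 \<notin> set (?t L)" for L using v(2) by auto
  have du: "distinct (?u L)" for L by (simp add: distinct_map)
  have "avoids ?w chi" unfolding avoids_def
  proof
    assume "contains ?w chi"
    from contains_chiE[OF this d] obtain a b c L
      where abc: "distinct [a, b, c]" and f: "filter (\<lambda>x. x \<in> L) ?w = [a, b, c, a, c, b]" by blast
    show False
    proof (cases "1 \<in> L")
      case False
      then show False using skip[of L] contains_chiI[OF abc] f av'[of chi] by (auto simp: avoids_def)
    next
      case True
      have e: "1 # ?u L @ 1 # ?t L = [a, b, c, a, c, b]" using f use1[OF True] by metis
      then have ab: "?u L = [b, c]" "?t L = [c, b]"
        using no1[of L] abc by (auto simp: append_eq_Cons_conv)
      have "subseq [b, c] (map Suc (up h))" unfolding ab[symmetric] by simp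
      then have "sorted_wrt (<) [b, c]"
        by (rule sorted_wrt_subseq) (use sorted_up[of h] in \<open>simp add: sorted_wrt_map\<close>)
      then have bc: "b < c" by simp
      have "{b, c} \<subseteq> set (map Suc (up h))" using ab(1) by (metis filter_is_subset list.set(1,2))
      then have "b \<le> Suc h" "c \<le> Suc h" by auto
      moreover have "subseq [c, b] (map Suc v)" unfolding ab(2)[symmetric] by simp
      ultimately have "subseq [c, b] (filter (\<lambda>x. x \<le> Suc h) (map Suc v))"
        using subseq_filter[of "[c, b]" "map Suc v" "\<lambda>x. x \<le> Suc h"] by simp
      also have "filter (\<lambda>x. x \<le> Suc h) (map Suc v) = map Suc (up h)"
        using v(1) by (simp add: filter_map comp_def)
      finally have "sorted_wrt (<) [c, b]"
        by (rule sorted_wrt_subseq) (use sorted_up[of h] in \<open>simp add: sorted_wrt_map\<close>)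
      then show False using bc by simp
    qed
  qed
  moreover have "avoids ?w chibar" unfolding avoids_def
  proof
    assume "contains ?w chibar"
    from contains_chibarE[OF this d] obtain a b c L
      where abc: "distinct [a, b, c]" and f: "filter (\<lambda>x. x \<in> L) ?w = [a, b, c, b, a, c]" by blast
    show False
    proof (cases "1 \<in> L")
      case False
      then show False using skip[of L] contains_chibarI[OF abc] f av'[of chibar] by (auto simp: avoids_def)
    next
      case True
      have e: "1 # ?u L @ 1 # ?t L = [a, b, c, b, a, c]" using f use1[OF True] by metis
      then have "?u L = [b, c, b]" using no1[of L] abc by (auto simp: append_eq_Cons_conv)
      then show False using du[of L] by simp
    qed
  qed
  moreover have "avoids ?w (lift \<sigma>)" unfolding avoids_def
  proof
    assume "contains ?w (lift \<sigma>)"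
    from contains_liftE[OF this d matching] obtain f x L
      where inj: "inj_on f (set \<sigma>)" and x: "x \<notin> f ` set \<sigma>"
        and f: "filter (\<lambda>y. y \<in> L) ?w = x # map f \<sigma> @ [x]" by blast
    show False
    proof (cases "1 \<in> L")
      case False
      then show False using skip[of L] contains_liftI[OF matching inj x] f av'[of "lift \<sigma>"]
        by (auto simp: avoids_def)
    next
      case True
      have e: "1 # ?u L @ 1 # ?t L = x # map f \<sigma> @ [x]" using f use1[OF True] by metis
      have "?t L = []"
      proof (rule ccontr)
        assume "?t L \<noteq> []"
        then have "last (?t L) = x" using arg_cong[OF e, of last] by simp
        then have "x \<in> set (?t L)" using \<open>?t L \<noteq> []\<close> last_in_set by blast
        then show False using no1 e by simp
      qed
      then have u: "?u L = map f \<sigma>" using e by simp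
      have "dow (map f \<sigma>)" using matching inj by (simp add: dow_map is_matching_iff)
      moreover have "distinct (map f \<sigma>)" using du[of L] u by simp
      ultimately show False using nonempty distinct_count_atmost_1[of "map f \<sigma>"]
        by (cases \<sigma>) (auto simp: dow_def)
    qed
  qed
  ultimately show ?thesis by simp
qed

lemma B_close_first:
  assumes v: "v \<in> B h n"
  shows "1 # map Suc v \<in> B (Suc h) (Suc n)"
proof -
  have z: "0 \<notin> set (up h) \<union> set v" using set_matching[OF B_matching[OF v]] by auto
  have f: "filter (\<lambda>x. x \<le> h) v = up h" using v by (simp add: B_def)
  have m: "is_matching (Suc n) (1 # map Suc (up h) @ 1 # map Suc v)"
    using is_matching_close_first[OF z] B_matching[OF v] by blast
  have "\<forall>s\<in>{lift \<sigma>, chi, chibar}. avoids (1 # map Suc (up h) @ 1 # map Suc v) s"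
    by (rule avoids_close_first) (use m f z v in \<open>auto simp: is_matching_iff B_def avoiding_set_def\<close>)
  moreover have "filter (\<lambda>x. x \<le> Suc h) (1 # map Suc v) = up (Suc h)"
    using f by (simp add: up_Suc_conv_Cons filter_map comp_def)
  ultimately show ?thesis using m by (simp add: B_def avoiding_set_def up_Suc_conv_Cons)
qed

text \<open>The third conclusion makes the head fail to be \<open>inner\<close>, which marks the end
  of the preceding block in \<open>takeWhile_inner_glue\<close>.\<close>

lemma A_imp_B:
  assumes "b \<in> A (Suc h) n"
  shows "b \<in> B (Suc h) n" "b \<noteq> []" "hd b = 1 \<or> subseq [Suc h, hd b] b"
proof -
  consider (up) v where "b = Suc (Suc h) # v" "v \<in> B (Suc (Suc h)) n"
    | (down) v where "b = 1 # map Suc v" "v \<in> B h (n - 1)" "n > 0"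
    using assms by (auto simp: A_def split: if_splits)
  then have "b \<in> B (Suc h) n \<and> b \<noteq> [] \<and> (hd b = 1 \<or> subseq [Suc h, hd b] b)"
  proof cases
    case up
    have "subseq [Suc h, Suc (Suc h)] (up (Suc (Suc h)))"
      using subseq_drop_many[of "[Suc h, Suc (Suc h)]" _ "up h"] by (simp add: up_Suc)
    also have "up (Suc (Suc h)) = filter (\<lambda>x. x \<le> Suc (Suc h)) v" using up(2) by (simp add: B_def)
    also have "subseq \<dots> v" by simp
    finally show ?thesis using up B_Suc_Cons[OF up(2)] by auto
  next
    case down
    then show ?thesis using B_close_first[OF down(2)] by simp
  qed
  then show "b \<in> B (Suc h) n" "b \<noteq> []" "hd b = 1 \<or> subseq [Suc h, hd b] b" by auto
qed

lemma avoids_subseq: "avoids w s \<Longrightarrow> subseq u w \<Longrightarrow> avoids u s"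
  using contains_subseq avoids_def by blast

text \<open>The head is an outer endpoint: either the closer 1 of the oldest open edge, which is
  stripped, or an opener whose edge outlasts \<open>Suc h\<close> and thus joins the queue of open
  edges.\<close>

lemma B_imp_A:
  assumes b: "b \<in> B (Suc h) n" "b \<noteq> []" and hd: "hd b = 1 \<or> (hd b > Suc h \<and> subseq [Suc h, hd b] b)"
  shows "b \<in> A (Suc h) n"
proof -
  obtain y t where yt: "b = y # t" using b(2) by (cases b) auto
  have m: "is_matching n (up (Suc h) @ y # t)" using B_matching b(1) yt by simp
  have sub: "set t \<subseteq> {1..n}" using set_matching[OF m] by auto
  have ft: "filter (\<lambda>x. x \<le> Suc h) (y # t) = up (Suc h)" using b(1) yt by (simp add: B_def)
  from hd yt consider "y = 1" | "y > Suc h" "subseq [Suc h, y] (y # t)" by auto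
  then show ?thesis
  proof cases
    case 1
    have "count_list (up (Suc h) @ y # t) 1 = 2" using m 1 by (simp add: is_matching_iff dow_def)
    then have "count_list t 1 = 0" using 1 by (simp add: up_Suc_conv_Cons)
    then have t1: "1 \<notin> set t" by (simp add: count_list_0_iff)
    have ge: "x \<ge> 2" if "x \<in> set t" for x
    proof -
      have "x \<noteq> 1" "x \<ge> 1" using that t1 sub by auto
      then show ?thesis by simp
    qed
    define v where "v = map (\<lambda>x. x - 1) t"
    have tv: "t = map Suc v" unfolding v_def map_map comp_def by (intro map_idI[symmetric]) (use ge in force)
    have z: "0 \<notin> set (up h) \<union> set v" using ge unfolding v_def by force
    have "n > 0" using set_matching[OF m] by (cases n) auto
    have w: "up (Suc h) @ y # t = 1 # map Suc (up h) @ 1 # map Suc v"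
      using 1 tv by (simp add: up_Suc_conv_Cons)
    have mv: "is_matching (n - 1) (up h @ v)"
      using is_matching_close_first[OF z, of "n - 1"] m w \<open>n > 0\<close> by simp
    have "map Suc (filter (\<lambda>x. x \<le> h) v) = map Suc (up h)"
      using ft 1 tv by (simp add: up_Suc_conv_Cons filter_map comp_def)
    then have "filter (\<lambda>x. x \<le> h) v = up h" by (simp add: inj_map_eq_map)
    moreover have "avoids (up h @ v) s" if "s \<in> {lift \<sigma>, chi, chibar}" for s
    proof -
      have "avoids (1 # map Suc (up h) @ 1 # map Suc v) s"
        using b(1) that w yt unfolding B_def avoiding_set_def by auto
      moreover have "subseq (map Suc (up h @ v)) (1 # map Suc (up h) @ 1 # map Suc v)"
        using subseq_outer[of "map Suc (up h)" "map Suc v" "[1]"] by auto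
      ultimately have "avoids (map Suc (up h @ v)) s" by (rule avoids_subseq)
      then show ?thesis by (simp add: avoids_def contains_map del: map_append)
    qed
    ultimately have "v \<in> B h (n - 1)" using mv by (simp add: B_def avoiding_set_def)
    then show ?thesis using yt 1 tv \<open>n > 0\<close> by (auto simp: A_def)
  next
    case 2
    have "firsts (up (Suc h) @ y # t) = up (Suc h) @ y # filter (\<lambda>x. x \<notin> {1..Suc h}) (filter (\<lambda>x. x \<noteq> y) (firsts t))"
      using 2 by (simp add: firsts_append firsts_distinct)
    then have "up (Suc h) @ y # filter (\<lambda>x. x \<notin> {1..Suc h}) (filter (\<lambda>x. x \<noteq> y) (firsts t)) = up n"
      using m by (simp add: is_matching_iff)
    \<comment> \<open>A letter that first occurs right after \<open>up (Suc h)\<close> must be the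
      next one.\<close>
    from append_eq_upD(3)[OF this] have "y = Suc (Suc h)"
      by (cases "n - Suc h") (auto simp: up_Suc_conv_Cons)
    have "count_list (up (Suc h) @ y # t) y = 2" using m by (simp add: is_matching_iff dow_def)
    then have c: "count_list t y = 1" using 2 by (simp add: count_notin)
    have "subseq [Suc h, y] t" using 2 by simp
    then obtain r1 r2 where r: "t = r1 @ Suc h # r2" "y \<in> set r2"
      by (rule subseq_pairE)
    \<comment> \<open>All letters up to \<open>h\<close> close before \<open>Suc h\<close>, hence in
      \<open>r1\<close>, while \<open>y\<close> closes in \<open>r2\<close>; so the closing order
      extends to \<open>y\<close>.\<close>
    have "filter (\<lambda>x. x \<le> Suc h) r1 @ Suc h # filter (\<lambda>x. x \<le> Suc h) r2 = up h @ [Suc h]"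
      using ft 2 r by (simp add: up_Suc)
    then have "filter (\<lambda>x. x \<le> Suc h) r2 = []" and f1: "filter (\<lambda>x. x \<le> Suc h) r1 = up h"
      by (auto simp: append_eq_append_conv2 append_eq_Cons_conv Cons_eq_append_conv)
         (metis atLeastAtMost_iff not_less_eq_eq order_refl set_up in_set_conv_decomp)+
    have "count_list r2 y = 1" "count_list r1 y = 0"
      using c r count_list_0_iff[of r2 y] 2 by auto
    then have "y \<notin> set r1" by (simp add: count_list_0_iff)
    then have f1': "filter (\<lambda>x. x \<le> Suc (Suc h)) r1 = up h"
      unfolding f1[symmetric] using \<open>y = Suc (Suc h)\<close> by (intro filter_cong) (auto simp: le_Suc_eq)
    have "filter (\<lambda>x. x \<le> Suc (Suc h)) r2 = filter (\<lambda>x. x = y) r2"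
      using \<open>filter (\<lambda>x. x \<le> Suc h) r2 = []\<close> \<open>y = Suc (Suc h)\<close>
      by (intro filter_cong) (auto simp: filter_empty_conv le_Suc_eq)
    also have "\<dots> = [y]" using \<open>count_list r2 y = 1\<close> by (simp add: filter_eq_replicate)
    finally have "filter (\<lambda>x. x \<le> Suc (Suc h)) t = up (Suc (Suc h))"
      using f1' r \<open>y = Suc (Suc h)\<close> by (simp add: up_Suc)
    then have "t \<in> B (Suc (Suc h)) n"
      using b(1) yt \<open>y = Suc (Suc h)\<close> by (simp add: B_def up_Suc)
    then show ?thesis using yt \<open>y = Suc (Suc h)\<close> by (simp add: A_def)
  qed
qed

section \<open>Decomposing a remainder into the filling of its first gap and the rest\<close>

text \<open>The order \<open>j\<close> of the filling \<open>g\<close> is both the amount of the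
  shift and the index of the later convolution.\<close>

definition glue :: "nat \<Rightarrow> nat \<times> nat list \<times> nat list \<Rightarrow> nat list" where
  "glue h = (\<lambda>(j, g, b). map (\<lambda>x. x + h) g @ map (shift_above h j) b)"

lemma glue_disjoint:
  assumes "is_matching j g"
  shows "set (map (\<lambda>x. x + h) g) \<inter> (set (up h) \<union> set (map (shift_above h j) b)) = {}"
  using set_matching[OF assms] by (auto simp: shift_above_def split: if_splits)

lemma glue_in_B:
  assumes g: "g \<in> avoiding_set {\<sigma>, chi, chibar} j" and b: "b \<in> B h m"
  shows "glue h (j, g, b) \<in> B h (j + m)"
proof -
  let ?g = "map (\<lambda>x. x + h) g" and ?b = "map (shift_above h j) b"
  have mg: "is_matching j g" using g by (simp add: avoiding_set_def)
  have m: "is_matching (j + m) (up h @ ?g @ ?b)"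
    by (rule is_matching_insert[OF mg B_matching[OF b]])
  then have d: "dow (up h @ ?g @ ?b)" by (simp add: is_matching_iff)
  note disj = glue_disjoint[OF mg, of h b]
  have fb: "filter (\<lambda>x. x \<le> h) b = up h" using b by (simp add: B_def)
  then have fb': "filter (\<lambda>x. x \<le> h) ?b = up h" by (simp add: filter_map comp_def)
  have fg: "filter (\<lambda>x. x \<le> h) ?g = []" using set_matching[OF mg] by (auto simp: filter_empty_conv)
  have ag: "avoids ?g s" if "s \<in> {\<sigma>, chi, chibar}" for s
    using g that unfolding avoids_def avoiding_set_def
    by (auto simp: contains_map inj_on_inj[OF inj_plus_nat] avoids_def)
  have ab: "avoids (up h @ ?b) s" if "s \<in> {lift \<sigma>, chi, chibar}" for s
  proof -
    have "avoids (up h @ b) s" using b that unfolding B_def avoiding_set_def by blast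
    then have "avoids (map (shift_above h j) (up h @ b)) s"
      by (simp add: avoids_def contains_map inj_on_inj[OF inj_shift_above] del: map_append)
    then show ?thesis by simp
  qed
  have "avoids (up h @ ?g @ ?b) chi"
    by (rule avoids_insert_blockless[OF blockless_chi dow_chi d disj]) (simp_all add: ag ab)
  moreover have "avoids (up h @ ?g @ ?b) chibar"
    by (rule avoids_insert_blockless[OF blockless_chibar dow_chibar d disj]) (simp_all add: ag ab)
  moreover have "avoids (up h @ ?g @ ?b) (lift \<sigma>)"
    by (rule avoids_insert_lift[OF matching conn d disj fb']) (simp_all add: ag ab)
  ultimately show ?thesis using m fb' fg by (simp add: B_def avoiding_set_def glue_def)
qed

text \<open>For an opener \<open>x\<close> occurring in a remainder \<open>v\<close>, being inner means being nested in the edge \<open>h\<close>.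
  Thus the filling of the first gap is recovered from \<open>v\<close> as its longest prefix of inner letters.\<close>

definition inner :: "nat \<Rightarrow> nat list \<Rightarrow> nat \<Rightarrow> bool" where
  "inner h v x \<longleftrightarrow> h < x \<and> \<not> subseq [h, x] v"

text \<open>Letters of \<open>g\<close> never follow the closer of \<open>Suc h\<close>, whereas the
  head of \<open>b\<close> is the closer 1 or recurs after \<open>Suc h\<close>. So the block can be
  read off from the glued word.\<close>

lemma takeWhile_inner_glue:
  assumes g: "is_matching j g" and b: "b \<in> A (Suc h) m"
  shows "takeWhile (inner (Suc h) (glue (Suc h) (j, g, b))) (glue (Suc h) (j, g, b)) = map (\<lambda>x. x + Suc h) g"
proof -
  let ?g = "map (\<lambda>x. x + Suc h) g" and ?b = "map (shift_above (Suc h) j) b"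
  let ?Q = "inner (Suc h) (glue (Suc h) (j, g, b))"
  note A = A_imp_B[OF b]
  have v: "glue (Suc h) (j, g, b) = ?g @ ?b" by (simp add: glue_def)
  note disj = glue_disjoint[OF g, of "Suc h" b]
  have "?Q x" if "x \<in> set ?g" for x
  proof -
    have "Suc h < x" using set_matching[OF g] that by auto
    moreover have "\<not> subseq [Suc h, x] (?g @ ?b)"
    proof
      assume "subseq [Suc h, x] (?g @ ?b)"
      then obtain u w where uw: "?g @ ?b = u @ Suc h # w" "x \<in> set w" by (rule subseq_pairE)
      have "Suc h \<notin> set ?g" using disj by force
      then have "x \<in> set ?b" using uw
        by (auto simp: append_eq_append_conv2 append_eq_Cons_conv Cons_eq_append_conv simp del: set_map)
      then show False using disj that by blast
    qed
    ultimately show ?thesis by (simp add: inner_def v)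
  qed
  moreover have "\<not> ?Q (hd ?b)"
  proof -
    have "hd b = 1 \<or> subseq [Suc h, hd b] b" by (rule A(3))
    then have "hd ?b = 1 \<or> subseq [Suc h, hd ?b] ?b"
    proof
      assume "subseq [Suc h, hd b] b"
      then have "subseq (map (shift_above (Suc h) j) [Suc h, hd b]) ?b" by (rule subseq_map)
      then show ?thesis using A(2) by (simp add: hd_map shift_above_def)
    qed (use A(2) in \<open>simp add: hd_map shift_above_def\<close>)
    then show ?thesis using subseq_drop_many[of _ ?b ?g] by (auto simp: inner_def v simp del: subseq_Cons2_iff)
  qed
  then have "takeWhile ?Q ?b = []" using A(2) by (cases b) auto
  ultimately show ?thesis unfolding v by (subst takeWhile_append2) (auto simp: v)
qed

text \<open>These facts are what \<open>is_matching_insertE\<close> and \<open>B_imp_A\<close>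
  require to split off the prefix of inner letters. Avoidance of \<open>chi\<close> and
  \<open>chibar\<close> enters through the first of them.\<close>

lemma block_closed:
  assumes v: "v \<in> B (Suc h) n"
  defines "Q \<equiv> inner (Suc h) v"
  shows "set (takeWhile Q v) \<inter> set (dropWhile Q v) = {}"
    "dropWhile Q v \<noteq> []"
    "hd (dropWhile Q v) = 1 \<or> (Suc h < hd (dropWhile Q v) \<and> subseq [Suc h, hd (dropWhile Q v)] (dropWhile Q v))"
proof -
  have fv: "filter (\<lambda>x. x \<le> Suc h) v = up (Suc h)" using v by (simp add: B_def)
  have av: "avoids (up (Suc h) @ v) chi" "avoids (up (Suc h) @ v) chibar"
    using v by (auto simp: B_def avoiding_set_def)
  define g where "g = takeWhile Q v"
  define r where "r = dropWhile Q v"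
  have vgr: "v = g @ r" by (simp add: g_def r_def)
  have Qg: "Q x" if "x \<in> set g" for x using that set_takeWhileD unfolding g_def by metis
  have hg: "Suc h < x" if "x \<in> set g" for x using Qg[OF that] by (simp add: Q_def inner_def)
  have "Suc h \<in> set (filter (\<lambda>x. x \<le> Suc h) v)" unfolding fv by simp
  then have hv: "Suc h \<in> set v" by simp
  then have hr: "Suc h \<in> set r" using vgr hg by auto
  then obtain y t where yt: "r = y # t" by (cases r) auto
  have nQy: "\<not> Q y" using yt by (simp add: r_def dropWhile_eq_Cons_conv)
  have "filter (\<lambda>x. x \<le> Suc h) g = []" using hg by (fastforce simp: filter_empty_conv)
  then have fr: "filter (\<lambda>x. x \<le> Suc h) (y # t) = up (Suc h)" using fv vgr yt by simp
  \<comment> \<open>The closing order makes the first letter up to \<open>Suc h\<close> equal to 1;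
    a larger letter that is not inner recurs after the closer of \<open>Suc h\<close>.\<close>
  have y: "y = 1 \<or> (Suc h < y \<and> subseq [Suc h, y] t)"
  proof (cases "y \<le> Suc h")
    case True then show ?thesis using fr by (simp add: up_Suc_conv_Cons)
  next
    case False
    then have "subseq [Suc h, y] v" using nQy by (simp add: Q_def inner_def)
    then obtain p q where pq: "v = p @ Suc h # q" "y \<in> set q" by (rule subseq_pairE)
    have "Suc h \<notin> set (g @ [y])" using hg False by auto
    moreover have "(g @ [y]) @ t = p @ Suc h # q" using vgr yt pq by simp
    ultimately obtain p' where "t = p' @ Suc h # q"
      by (fastforce simp: append_eq_append_conv2 append_eq_Cons_conv Cons_eq_append_conv)
    then show ?thesis using pq(2) False subseq_pairI by simp
  qed
  \<comment> \<open>Otherwise the edge \<open>y\<close> crosses both the edge \<open>h + 1\<close> and the edge \<open>x\<close> nested in it.\<close>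
  have False if x: "x \<in> set g" "x \<in> set r" for x
  proof -
    have xQ: "Suc h < x" "\<not> subseq [Suc h, x] v" using Qg[OF x(1)] by (simp_all add: Q_def inner_def)
    have "x \<noteq> y" using nQy Qg[OF x(1)] by auto
    then have xt: "x \<in> set t" using x(2) yt by simp
    \<comment> \<open>As \<open>x\<close> is inner, no vertex of it follows the closer of
      \<open>Suc h\<close>.\<close>
    have before: "x \<in> set r1" if "t = r1 @ Suc h # r2" for r1 r2
    proof (rule ccontr)
      assume "x \<notin> set r1"
      then have "x \<in> set r2" using xt xQ(1) that by auto
      then have "subseq [Suc h, x] v" using subseq_pairI[of x r2 "Suc h" "g @ y # r1"] vgr yt that by simp
      then show False using xQ(2) by simp
    qed
    have gx: "subseq [x] g" using x(1) by (simp add: subseq_singleton_left)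
    from y show False
    proof
      assume y1: "y = 1"
      show False
      \<comment> \<open>For \<open>h = 0\<close> the letter 1 is the edge \<open>Suc h\<close>
        itself, so \<open>x\<close> would follow its closer; otherwise 1, \<open>Suc h\<close> and
        \<open>x\<close> form \<open>chi\<close>.\<close>
      proof (cases h)
        case 0
        then have "subseq [Suc h, x] v" using subseq_pairI[of x t "Suc h" g] vgr yt y1 xt by simp
        then show False using xQ(2) by simp
      next
        case (Suc h')
        have "Suc h \<in> set t" using hr yt y1 Suc by auto
        then obtain r1 r2 where r: "t = r1 @ Suc h # r2" by (meson split_list)
        have "subseq ([1, Suc h] @ [x] @ [1] @ [x] @ [Suc h]) (up (Suc h) @ g @ [y] @ r1 @ Suc h # r2)"
        proof (intro list_emb_append_mono gx)
          show "subseq [1, Suc h] (up (Suc h))" unfolding Suc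
            by (subst up_Suc_conv_Cons) (simp add: subseq_singleton_left image_iff)
          show "subseq [x] r1" using before[OF r] by (simp add: subseq_singleton_left)
        qed (use y1 in auto)
        then have "subseq [1, Suc h, x, 1, x, Suc h] (up (Suc h) @ v)" using vgr yt r by simp
        then have "contains (up (Suc h) @ v) chi" using xQ(1) Suc by (intro contains_chiI) auto
        then show False using av(1) by (simp add: avoids_def)
      qed
    next
      assume y2: "Suc h < y \<and> subseq [Suc h, y] t"
      then obtain r1 r2 where r: "t = r1 @ Suc h # r2" "y \<in> set r2" by (meson subseq_pairE)
      have "subseq ([Suc h] @ [x] @ [y] @ [x] @ [Suc h, y]) (up (Suc h) @ g @ [y] @ r1 @ Suc h # r2)"
      proof (intro list_emb_append_mono gx)
        show "subseq [x] r1" using before[OF r(1)] by (simp add: subseq_singleton_left)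
      qed (use r(2) in \<open>auto simp: subseq_singleton_left\<close>)
      then have "subseq [Suc h, x, y, x, Suc h, y] (up (Suc h) @ v)" using vgr yt r by simp
      then have "contains (up (Suc h) @ v) chibar"
        using xQ(1) y2 \<open>x \<noteq> y\<close> by (intro contains_chibarI) auto
      then show False using av(2) by (simp add: avoids_def)
    qed
  qed
  then show "set (takeWhile Q v) \<inter> set (dropWhile Q v) = {}" unfolding g_def r_def by blast
  show "dropWhile Q v \<noteq> []" using yt by (simp add: r_def)
  show "hd (dropWhile Q v) = 1 \<or> (Suc h < hd (dropWhile Q v) \<and> subseq [Suc h, hd (dropWhile Q v)] (dropWhile Q v))"
    using y yt unfolding r_def[symmetric] by auto
qed

lemma B_in_glue:
  assumes v: "v \<in> B (Suc h) n"
  obtains j g b where "j \<le> n" "g \<in> avoiding_set {\<sigma>, chi, chibar} j" "b \<in> A (Suc h) (n - j)"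
    "v = glue (Suc h) (j, g, b)"
proof -
  define Q where "Q = inner (Suc h) v"
  define g' where "g' = takeWhile Q v"
  define r where "r = dropWhile Q v"
  have vgr: "v = g' @ r" by (simp add: g'_def r_def)
  note bl = block_closed[OF v, folded Q_def, folded g'_def r_def]
  have hg: "Suc h < x" if "x \<in> set g'" for x
    using that set_takeWhileD[of x Q v] unfolding g'_def by (simp add: Q_def inner_def)
  have "is_matching n (up (Suc h) @ g' @ r)" using B_matching[OF v] vgr by simp
  from is_matching_insertE[OF this bl(1) hg] obtain j g b where
    j: "j \<le> n" "is_matching j g" and g: "g' = map (\<lambda>x. x + Suc h) g"
    and mb: "is_matching (n - j) (up (Suc h) @ b)" and b: "r = map (shift_above (Suc h) j) b" by blast
  have av: "avoids (up (Suc h) @ v) s" if "s \<in> {lift \<sigma>, chi, chibar}" for s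
    using v that unfolding B_def avoiding_set_def by blast
  have fv: "filter (\<lambda>x. x \<le> Suc h) v = up (Suc h)" using v by (simp add: B_def)
  have "filter (\<lambda>x. x \<le> Suc h) g' = []" using hg by (fastforce simp: filter_empty_conv)
  then have fr: "filter (\<lambda>x. x \<le> Suc h) r = up (Suc h)" using fv vgr by simp
  have "Suc h \<in> set (filter (\<lambda>x. x \<le> Suc h) r)" unfolding fr by simp
  then have hr: "Suc h \<in> set r" by simp
  have "g \<in> avoiding_set {\<sigma>, chi, chibar} j"
  proof -
    have gg: "avoids g' s \<Longrightarrow> avoids g s" for s
      unfolding g avoids_def by (simp only: contains_map[OF inj_on_inj[OF inj_plus_nat]] simp_thms)
    have sg: "subseq g' (up (Suc h) @ v)" unfolding vgr by (rule subseq_middle)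
    have "avoids g' \<sigma>" unfolding avoids_def
    proof
      assume "contains g' \<sigma>"
      then obtain f where f: "inj_on f (set \<sigma>)" "subseq (map f \<sigma>) g'" unfolding contains_iff by blast
      have x: "Suc h \<notin> f ` set \<sigma>" using set_subseq[OF f(2)] hg by fastforce
      \<comment> \<open>The edge \<open>Suc h\<close> opens before the block and closes after it, so
        together with a copy of \<open>\<sigma>\<close> it would form
        \<open>lift \<sigma>\<close>.\<close>
      have "subseq ([Suc h] @ map f \<sigma> @ [Suc h]) (up (Suc h) @ g' @ r)"
        by (intro list_emb_append_mono f(2)) (use hr in \<open>auto simp: subseq_singleton_left\<close>)
      then have "contains (up (Suc h) @ v) (lift \<sigma>)"
        using contains_liftI[OF matching f(1) x] vgr by simp
      then show False using av[of "lift \<sigma>"] by (simp add: avoids_def)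
    qed
    moreover have "avoids g' chi" "avoids g' chibar"
      using av[of chi] av[of chibar] avoids_subseq[OF _ sg] by auto
    ultimately show ?thesis using j(2) gg by (simp add: avoiding_set_def)
  qed
  moreover have "b \<in> A (Suc h) (n - j)"
  proof (rule B_imp_A)
    have "map (shift_above (Suc h) j) (filter (\<lambda>x. x \<le> Suc h) b) = map (shift_above (Suc h) j) (up (Suc h))"
      using fr unfolding b by (simp add: filter_map comp_def)
    then have "filter (\<lambda>x. x \<le> Suc h) b = up (Suc h)" by (simp only: inj_map_eq_map[OF inj_shift_above])
    moreover have "avoids (up (Suc h) @ b) s" if "s \<in> {lift \<sigma>, chi, chibar}" for s
    proof -
      have "avoids (up (Suc h) @ r) s"
        using avoids_subseq[OF av[OF that]] subseq_outer[of "up (Suc h)" r g'] vgr by simp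
      then have "avoids (map (shift_above (Suc h) j) (up (Suc h) @ b)) s" by (simp add: b)
      then show ?thesis
        by (simp add: avoids_def contains_map inj_on_inj[OF inj_shift_above] del: map_append)
    qed
    ultimately show "b \<in> B (Suc h) (n - j)" using mb by (simp add: B_def avoiding_set_def)
    show "b \<noteq> []" using bl(2) b by auto
    then have hd: "hd r = shift_above (Suc h) j (hd b)" unfolding b by (rule hd_map)
    from bl(3) show "hd b = 1 \<or> (Suc h < hd b \<and> subseq [Suc h, hd b] b)"
    proof
      assume "hd r = 1"
      then show ?thesis using hd by (auto simp: shift_above_def split: if_splits)
    next
      assume a: "Suc h < hd r \<and> subseq [Suc h, hd r] r"
      then have "subseq (map (shift_above (Suc h) j) [Suc h, hd b]) (map (shift_above (Suc h) j) b)"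
        by (simp add: hd b[symmetric]) (simp add: shift_above_def)
      then have "subseq [Suc h, hd b] b" by (simp only: subseq_map_inj[OF inj_shift_above])
      moreover have "Suc h < hd b" using a hd by (auto simp: shift_above_def split: if_splits)
      ultimately show ?thesis by simp
    qed
  qed
  ultimately show ?thesis using that j vgr g b by (simp add: glue_def)
qed

text \<open>The inner prefix determines \<open>g\<close>, its length determines \<open>j\<close>,
  and undoing the shift determines \<open>b\<close>; surjectivity is
  \<open>B_in_glue\<close>.\<close>

lemma bij_glue:
  "bij_betw (glue (Suc h))
     (SIGMA j:{..n}. avoiding_set {\<sigma>, chi, chibar} j \<times> A (Suc h) (n - j)) (B (Suc h) n)"
proof (rule bij_betw_imageI)
  let ?S = "SIGMA j:{..n}. avoiding_set {\<sigma>, chi, chibar} j \<times> A (Suc h) (n - j)"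
  show "inj_on (glue (Suc h)) ?S"
  proof (rule inj_onI)
    fix p q assume pq: "p \<in> ?S" "q \<in> ?S" "glue (Suc h) p = glue (Suc h) q"
    obtain j1 g1 b1 j2 g2 b2 where p: "p = (j1, g1, b1)" and q: "q = (j2, g2, b2)"
      by (cases p, cases q) auto
    have 1: "g1 \<in> avoiding_set {\<sigma>, chi, chibar} j1" "b1 \<in> A (Suc h) (n - j1)"
      and 2: "g2 \<in> avoiding_set {\<sigma>, chi, chibar} j2" "b2 \<in> A (Suc h) (n - j2)"
      and eq: "glue (Suc h) (j1, g1, b1) = glue (Suc h) (j2, g2, b2)"
      using pq p q by auto
    have m: "is_matching j1 g1" "is_matching j2 g2" using 1 2 by (auto simp: avoiding_set_def)
    have "map (\<lambda>x. x + Suc h) g1 = map (\<lambda>x. x + Suc h) g2"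
      using takeWhile_inner_glue[OF m(1) 1(2)] takeWhile_inner_glue[OF m(2) 2(2)] eq by metis
    then have g: "g1 = g2" by (simp only: inj_map_eq_map[OF inj_plus_nat])
    then have j: "j1 = j2" using m by (simp add: is_matching_def)
    have "map (shift_above (Suc h) j1) b1 = map (shift_above (Suc h) j1) b2"
      using eq g j by (simp add: glue_def)
    then have "b1 = b2" by (simp only: inj_map_eq_map[OF inj_shift_above])
    then show "p = q" using g j p q by simp
  qed
  show "glue (Suc h) ` ?S = B (Suc h) n"
  proof (intro equalityI subsetI)
    fix v assume "v \<in> glue (Suc h) ` ?S"
    then obtain j g b where "j \<le> n" "g \<in> avoiding_set {\<sigma>, chi, chibar} j" "b \<in> A (Suc h) (n - j)"
      "v = glue (Suc h) (j, g, b)" by auto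
    then show "v \<in> B (Suc h) n" using glue_in_B[of g j b "Suc h" "n - j"] A_imp_B(1) by simp
  next
    fix v assume "v \<in> B (Suc h) n"
    then obtain j g b where "j \<le> n" "g \<in> avoiding_set {\<sigma>, chi, chibar} j" "b \<in> A (Suc h) (n - j)"
      "v = glue (Suc h) (j, g, b)" by (rule B_in_glue)
    then show "v \<in> glue (Suc h) ` ?S" by (intro image_eqI) auto
  qed
qed

section \<open>Generating functions\<close>

definition Bgf :: "nat \<Rightarrow> rat fps" where
  "Bgf h = Abs_fps (\<lambda>n. of_nat (card (B h n)))"

text \<open>The two continuations start with different letters. The case \<open>n = 0\<close> is
  split off because truncated subtraction would count \<open>B 0 0\<close>, which is nonempty; it
  mirrors the zero constant term of \<open>fps_X * Bgf h\<close>.\<close>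

lemma card_A: "card (A (Suc h) n) = card (B (Suc (Suc h)) n) + (if n = 0 then 0 else card (B h (n - 1)))"
proof -
  have i: "inj_on (\<lambda>v. Suc 0 # map Suc v) X" for X by (auto simp: inj_on_def inj_map_eq_map)
  have "card (A (Suc h) n) = card ((#) (Suc (Suc h)) ` B (Suc (Suc h)) n)
      + card (if n = 0 then {} else (\<lambda>v. 1 # map Suc v) ` B h (n - 1))"
    unfolding A_def by (subst card_Un_disjoint) (auto simp: finite_B)
  then show ?thesis by (simp add: card_image i)
qed

text \<open>Counting both sides of \<open>bij_glue\<close> gives a Cauchy product indexed by the
  order of the filling.\<close>

lemma Bgf_Suc: "Bgf (Suc h) = Mgf {\<sigma>, chi, chibar} * (Bgf (Suc (Suc h)) + fps_X * Bgf h)"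
proof (rule fps_ext)
  fix n
  have F: "fps_nth (Bgf (Suc (Suc h)) + fps_X * Bgf h) m = of_nat (card (A (Suc h) m))" for m
    by (simp add: Bgf_def card_A)
  have "card (B (Suc h) n) = (\<Sum>j\<le>n. card (avoiding_set {\<sigma>, chi, chibar} j) * card (A (Suc h) (n - j)))"
    using bij_betw_same_card[OF bij_glue[of h n]]
    by (simp add: card_SigmaI finite_avoiding_set finite_A card_cartesian_product)
  then have "fps_nth (Bgf (Suc h)) n = (\<Sum>j = 0..n. fps_nth (Mgf {\<sigma>, chi, chibar}) j
      * fps_nth (Bgf (Suc (Suc h)) + fps_X * Bgf h) (n - j))"
    unfolding F by (simp add: Bgf_def Mgf_def atLeast0AtMost)
  also have "\<dots> = fps_nth (Mgf {\<sigma>, chi, chibar} * (Bgf (Suc (Suc h)) + fps_X * Bgf h)) n"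
    by (rule fps_mult_nth[symmetric])
  finally show "fps_nth (Bgf (Suc h)) n = fps_nth (Mgf {\<sigma>, chi, chibar} * (Bgf (Suc (Suc h)) + fps_X * Bgf h)) n" .
qed

text \<open>The summand 1 is the empty matching, which \<open>B 1 0\<close> does not account
  for.\<close>

lemma Bgf_0: "Bgf 0 = 1 + Bgf 1"
proof (rule fps_ext)
  fix n show "fps_nth (Bgf 0) n = fps_nth (1 + Bgf 1) n"
    by (cases "n = 0") (auto simp: Bgf_def B_0_0 B_empty B_0_pos card_image)
qed

lemma Mgf_lift:
  "Mgf {lift \<sigma>, chi, chibar} =
    inverse (1 - fps_X * Mgf {\<sigma>, chi, chibar}
                 * fps_compose catalan_fps (fps_X * (Mgf {\<sigma>, chi, chibar})\<^sup>2))"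
proof -
  have "Mgf {lift \<sigma>, chi, chibar} = Bgf 0" by (simp add: Mgf_def Bgf_def B_0)
  also have "\<dots> = inverse (1 - fps_X * Mgf {\<sigma>, chi, chibar}
                 * fps_compose catalan_fps (fps_X * (Mgf {\<sigma>, chi, chibar})\<^sup>2))"
    by (rule kernel_solution[OF Bgf_0 Bgf_Suc]) (simp add: Bgf_def B_empty)
  finally show ?thesis .
qed

end

theorem theorem2:
  fixes \<sigma> :: "nat list" and k :: nat
  assumes "is_matching k \<sigma>" and "connected_matching \<sigma>"
  shows "Mgf {lift \<sigma>, chi, chibar} =
    inverse (1 - fps_X * Mgf {\<sigma>, chi, chibar}
                 * fps_compose catalan_fps (fps_X * (Mgf {\<sigma>, chi, chibar})\<^sup>2))"
proof -
  interpret connected_pattern \<sigma> k using assms by unfold_locales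
  show ?thesis by (rule Mgf_lift)
qed

end
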